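(* Let $(P_1,P_2)$ and $(Q_1,Q_2)$ be two pairs of cameras with different fundamental forms, with centers $p_1\neq p_2$ and $q_1\ne q_2$, and let $S_P,S_Q$, their strict transforms $\widetilde{S_P},\widetilde{S_Q}$, the epipolar lines $\widetilde{g_{P_1}^2},\widetilde{g_{P_2}^1}$, and $I\subset\widetilde{S_P}\times\widetilde{S_Q}$ with first projection $\pi_1: I\to\widetilde{S_P}$ be the associated objects. Then: (1) If $\widetilde{S_P}$ is smooth, the map $\pi_1$ is an isomorphism. (2) The map $\psi_P$ taking a point $x\in\widetilde{S_P}$ to its conjugate is a birational map, defined everywhere except the intersection $\widetilde{g_{P_1}^2}\cap\widetilde{g_{P_2}^1}$. (3) The quadric $S_P$ is singular if and only if the quadric $S_Q$ contains the line spanned by the camera centers $q_1,q_2$. (4) For any point $x\in\widetilde{g_{P_1}^2}$ or $\widetilde{g_{P_2}^1}$ (but not both), the conjugate $\psi_P(x)$ is a point on the exceptional divisor obtained when blowing up $q_2$ or $q_1$ respectively. In particular, on the blow-down $S_P\subset\mathbb{P}^3$, the conjugate to any point $x\in g_{P_1}^2$ or $x\in g_{P_2}^1$ (apart from the camera centers themselves) is the camera center $q_2$ or $q_1$ respectively.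
   Context: $\mathbb{P}^n$ is projective space over $\mathbb{C}$. A camera is a linear projection $P:\mathbb{P}^3\dashrightarrow\mathbb{P}^2$ given by a real $3\times4$ matrix of rank $3$; its center is the kernel of the matrix. For a pair of cameras $(P_1,P_2)$ with distinct centers, $\widetilde{\mathbb{P}^3_P}$ is the blow-up of $\mathbb{P}^3$ in $p_1,p_2$; the $P_i$ extend to morphisms $\widetilde{\mathbb{P}^3_P}\to\mathbb{P}^2$, and $\widetilde{\phi_P}=P_1\times P_2:\widetilde{\mathbb{P}^3_P}\to\mathbb{P}^2\times\mathbb{P}^2$ is the joint camera map. Similarly for $Q$. The image of $\widetilde{\phi_P}$ is the zero locus of the fundamental form, the real rank $2$ bilinear form $F_P(\mathbf{x},\mathbf{y})=\det\begin{bmatrix}P_1&\mathbf{x}&0\\P_2&0&\mathbf{y}\end{bmatrix}$ (up to scale); similarly $F_Q$. Assume $F_P\ne F_Q$. The quadrics $S_P,S_Q\subset\mathbb{P}^3$ are given by $S_P(x)=F_Q(P_1(x),P_2(x))$ and $S_Q(x)=F_P(Q_1(x),Q_2(x))$. $\widetilde{S_P}\subset\widetilde{\mathbb{P}^3_P}$ denotes the strict transform of $S_P$, and $\widetilde{S_Q}\subset\widetilde{\mathbb{P}^3_Q}$ the strict transform of $S_Q$. The epipolar lines are $\widetilde{g_{P_1}^2}=P_1^{-1}(Q_1(q_2))$ and $\widetilde{g_{P_2}^1}=P_2^{-1}(Q_2(q_1))$ in $\widetilde{\mathbb{P}^3_P}$; their blow-downs $g_{P_1}^2\ni p_1$ and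 $g_{P_2}^1\ni p_2$ are lines on $S_P$. $I=\{(x,y)\in\widetilde{S_P}\times\widetilde{S_Q}\mid\widetilde{\phi_P}(x)=\widetilde{\phi_Q}(y)\}$. Points $x\in\widetilde{S_P}$, $y\in\widetilde{S_Q}$ are conjugate if $(x,y)\in I$.
   Formalization: In (1), smoothness of the strict transform means that the equation F_Q(P_1,P_2)=0 on the blow-up has nonvanishing differential along it; this excludes S_P singular at a camera center (e.g. a cone with vertex p_1), where the strict transform can be smooth but π_1 is not injective. *)

theory Defs
  imports "HOL-Analysis.Analysis"
begin

section \<open>Complex projective space\<close>

typedef 'n proj = "{L :: (complex^'n::finite) set. vec.subspace L \<and> vec.dim L = 1}"
proof -
  have "vec.dim (vec.span {axis undefined 1 :: complex^'n}) = 1"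
    by (simp add: vec.dim_eq_card_independent axis_eq_0_iff vec.dim_span_eq_card_independent)
  then show ?thesis
    by (auto intro!: exI[of _ "vec.span {axis undefined 1 :: complex^'n}"] vec.subspace_span)
qed

text \<open>Homogeneous coordinate vectors of a point, and of points of the (multi-)projective spaces
  that contain the blow-up and the product of two blow-ups.\<close>

definition hvecs :: "'n::finite proj \<Rightarrow> (complex^'n) set"
  where "hvecs p = Rep_proj p - {0}"

type_synonym bpoint = "4 proj \<times> 3 proj \<times> 3 proj"
type_synonym bvec = "(complex^4) \<times> (complex^3) \<times> (complex^3)"

definition bvecs :: "bpoint \<Rightarrow> bvec set"
  where "bvecs = (\<lambda>(x, u, v). hvecs x \<times> hvecs u \<times> hvecs v)"

definition bbvecs :: "bpoint \<times> bpoint \<Rightarrow> (bvec \<times> bvec) set"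
  where "bbvecs = (\<lambda>(z, w). bvecs z \<times> bvecs w)"

definition proj_line :: "'n::finite proj \<Rightarrow> 'n proj \<Rightarrow> 'n proj set"
  where "proj_line p q = {r. Rep_proj r \<subseteq> vec.span (Rep_proj p \<union> Rep_proj q)}"


section \<open>Zariski topology and regular maps\<close>

class coord_space =
  fixes coord_fun :: "('a \<Rightarrow> complex) set"

instantiation complex :: coord_space
begin
definition coord_fun_complex :: "(complex \<Rightarrow> complex) set"
  where "coord_fun_complex = {\<lambda>z. z}"
instance ..
end

instantiation vec :: (coord_space, finite) coord_space
begin
definition coord_fun_vec :: "('a^'b \<Rightarrow> complex) set"
  where "coord_fun_vec = {\<lambda>x. f (x $ i) | f i. f \<in> coord_fun}"
instance ..
end

instantiation prod :: (coord_space, coord_space) coord_space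
begin
definition coord_fun_prod :: "('a \<times> 'b \<Rightarrow> complex) set"
  where "coord_fun_prod = {\<lambda>z. f (fst z) | f. f \<in> coord_fun} \<union> {\<lambda>z. f (snd z) | f. f \<in> coord_fun}"
instance ..
end

inductive_set polyfun :: "('a::coord_space \<Rightarrow> complex) set" where
  const: "(\<lambda>_. c) \<in> polyfun"
| coord: "f \<in> coord_fun \<Longrightarrow> f \<in> polyfun"
| add: "f \<in> polyfun \<Longrightarrow> g \<in> polyfun \<Longrightarrow> (\<lambda>x. f x + g x) \<in> polyfun"
| mult: "f \<in> polyfun \<Longrightarrow> g \<in> polyfun \<Longrightarrow> (\<lambda>x. f x * g x) \<in> polyfun"

text \<open>In the following, \<open>R p\<close> is the set of all homogeneous coordinate vectors of the point \<open>p\<close>.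
  The polynomials need not be multihomogeneous: a polynomial vanishes at all coordinate
  vectors of a point iff all its multihomogeneous components do, so the closed sets are the usual
  ones, and likewise a polynomial map in \<open>regular_map\<close> may be replaced, locally, by
  multihomogeneous components.\<close>

definition zero_locus :: "('p \<Rightarrow> 'v set) \<Rightarrow> ('v \<Rightarrow> complex) set \<Rightarrow> 'p set"
  where "zero_locus R F = {p. \<forall>f\<in>F. \<forall>v\<in>R p. f v = 0}"

definition zclosed :: "('p \<Rightarrow> 'v::coord_space set) \<Rightarrow> 'p set \<Rightarrow> bool"
  where "zclosed R Z \<longleftrightarrow> (\<exists>F \<subseteq> polyfun. Z = zero_locus R F)"

definition zclosure :: "('p \<Rightarrow> 'v::coord_space set) \<Rightarrow> 'p set \<Rightarrow> 'p set"
  where "zclosure R A = \<Inter>{Z. zclosed R Z \<and> A \<subseteq> Z}"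

definition zopen_dense_in :: "('p \<Rightarrow> 'v::coord_space set) \<Rightarrow> 'p set \<Rightarrow> 'p set \<Rightarrow> bool"
  where "zopen_dense_in R U X \<longleftrightarrow> (\<exists>Z. zclosed R Z \<and> U = X - Z) \<and> X \<subseteq> zclosure R U"

definition regular_map ::
  "('p \<Rightarrow> 'v::coord_space set) \<Rightarrow> ('q \<Rightarrow> 'w::coord_space set) \<Rightarrow> 'p set \<Rightarrow> 'q set \<Rightarrow> ('p \<Rightarrow> 'q) \<Rightarrow> bool"
  where "regular_map R S X Y f \<longleftrightarrow> f ` X \<subseteq> Y \<and>
    (\<forall>p\<in>X. \<exists>Z G. zclosed R Z \<and> p \<notin> Z \<and> (\<forall>c\<in>coord_fun. (\<lambda>v. c (G v)) \<in> polyfun) \<and>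
       (\<forall>q\<in>X - Z. \<forall>v\<in>R q. G v \<in> S (f q)))"

definition variety_iso ::
  "('p \<Rightarrow> 'v::coord_space set) \<Rightarrow> ('q \<Rightarrow> 'w::coord_space set) \<Rightarrow> 'p set \<Rightarrow> 'q set \<Rightarrow> ('p \<Rightarrow> 'q) \<Rightarrow> bool"
  where "variety_iso R S X Y f \<longleftrightarrow>
    bij_betw f X Y \<and> regular_map R S X Y f \<and> regular_map S R Y X (inv_into X f)"

text \<open>The varieties may be reducible, so birational means: an isomorphism between dense open subsets.
  \<open>D\<close> is the set on which the map \<open>f\<close> is defined.\<close>

definition birational_map ::
  "('p \<Rightarrow> 'v::coord_space set) \<Rightarrow> ('q \<Rightarrow> 'w::coord_space set) \<Rightarrow> 'p set \<Rightarrow> 'q set \<Rightarrow> 'p set \<Rightarrow> ('p \<Rightarrow> 'q) \<Rightarrow> bool"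
  where "birational_map R S X Y D f \<longleftrightarrow>
    zopen_dense_in R D X \<and> regular_map R S D Y f \<and>
    (\<exists>U V. zopen_dense_in R U X \<and> zopen_dense_in S V Y \<and> U \<subseteq> D \<and> variety_iso R S U V f)"


section \<open>Cameras and the fundamental form\<close>

type_synonym camera = "real^4^3"

definition is_camera :: "camera \<Rightarrow> bool"
  where "is_camera C \<longleftrightarrow> rank C = 3"

definition cmat :: "camera \<Rightarrow> complex^4^3"
  where "cmat C = (\<chi> i j. complex_of_real (C $ i $ j))"

definition center :: "camera \<Rightarrow> 4 proj"
  where "center C = Abs_proj {x. cmat C *v x = 0}"

text \<open>Meaningful only away from the center.\<close>

definition picture :: "camera \<Rightarrow> 4 proj \<Rightarrow> 3 proj"
  where "picture C x = Abs_proj ((*v) (cmat C) ` Rep_proj x)"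

definition block_row :: "complex^4 \<Rightarrow> complex \<Rightarrow> complex \<Rightarrow> complex^(3 + 3)"
  where "block_row w s t = (\<chi> j. case j of
      Inl k \<Rightarrow> if k = 1 then w $ 1 else if k = 2 then w $ 2 else w $ 3
    | Inr k \<Rightarrow> if k = 1 then w $ 4 else if k = 2 then s else t)"

text \<open>The rows and columns of the \<open>6 \<times> 6\<close> matrix are indexed by the sum type \<open>3 + 3\<close>; the columns are
  the four columns of the cameras followed by \<open>(u, 0)\<close> and \<open>(0, v)\<close>.\<close>

definition fund_form :: "camera \<times> camera \<Rightarrow> complex^3 \<Rightarrow> complex^3 \<Rightarrow> complex"
  where "fund_form P u v = det (\<chi> i. case i of
      Inl k \<Rightarrow> block_row (cmat (fst P) $ k) (u $ k) 0
    | Inr k \<Rightarrow> block_row (cmat (snd P) $ k) 0 (v $ k))"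

definition same_fund_form :: "camera \<times> camera \<Rightarrow> camera \<times> camera \<Rightarrow> bool"
  where "same_fund_form P Q \<longleftrightarrow> (\<exists>c. c \<noteq> 0 \<and> (\<forall>u v. fund_form P u v = c * fund_form Q u v))"


section \<open>The blow-up and the joint camera map\<close>

text \<open>The blow-up of \<open>\<P>\<^sup>3\<close> in \<open>p\<^sub>1\<close> and \<open>p\<^sub>2\<close> as an incidence variety in \<open>\<P>\<^sup>3 \<times> \<P>\<^sup>2 \<times> \<P>\<^sup>2\<close>: blowing up
  \<open>p\<^sub>i\<close> resolves the projection \<open>P\<^sub>i\<close> from \<open>p\<^sub>i\<close>, and the blow-up consists of the \<open>(x, u, v)\<close> such that
  \<open>P\<^sub>1 x\<close> is proportional to \<open>u\<close> and \<open>P\<^sub>2 x\<close> to \<open>v\<close>. The blow-down is the first projection, and the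
  extended cameras are the other two projections.\<close>

definition blowup_eqs :: "camera \<times> camera \<Rightarrow> (bvec \<Rightarrow> complex) set"
  where "blowup_eqs P =
     {\<lambda>(x, u, v). (cmat (fst P) *v x) $ i * u $ j - (cmat (fst P) *v x) $ j * u $ i | i j. True}
   \<union> {\<lambda>(x, u, v). (cmat (snd P) *v x) $ i * v $ j - (cmat (snd P) *v x) $ j * v $ i | i j. True}"

definition blowup :: "camera \<times> camera \<Rightarrow> bpoint set"
  where "blowup P = zero_locus bvecs (blowup_eqs P)"

definition blowdown :: "bpoint \<Rightarrow> 4 proj"
  where "blowdown = (\<lambda>(x, u, v). x)"

definition cam1 :: "bpoint \<Rightarrow> 3 proj"
  where "cam1 = (\<lambda>(x, u, v). u)"

definition cam2 :: "bpoint \<Rightarrow> 3 proj"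
  where "cam2 = (\<lambda>(x, u, v). v)"

definition joint_camera_map :: "bpoint \<Rightarrow> 3 proj \<times> 3 proj"
  where "joint_camera_map z = (cam1 z, cam2 z)"

definition exc_divisor :: "camera \<times> camera \<Rightarrow> 4 proj \<Rightarrow> bpoint set"
  where "exc_divisor P p = {z \<in> blowup P. blowdown z = p}"


section \<open>The quadrics and their strict transforms\<close>

text \<open>\<open>quadric_form P Q\<close> is the equation of \<open>S\<^sub>P\<close>, and \<open>quadric_form Q P\<close> that of \<open>S\<^sub>Q\<close>.\<close>

definition quadric_form :: "camera \<times> camera \<Rightarrow> camera \<times> camera \<Rightarrow> complex^4 \<Rightarrow> complex"
  where "quadric_form P Q x = fund_form Q (cmat (fst P) *v x) (cmat (snd P) *v x)"

definition quadric :: "camera \<times> camera \<Rightarrow> camera \<times> camera \<Rightarrow> 4 proj set"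
  where "quadric P Q = zero_locus hvecs {quadric_form P Q}"

text \<open>Singularities are those of the quadric as a divisor; a double plane is singular.\<close>

definition quadric_singular :: "camera \<times> camera \<Rightarrow> camera \<times> camera \<Rightarrow> bool"
  where "quadric_singular P Q \<longleftrightarrow>
    (\<exists>x. x \<noteq> 0 \<and> quadric_form P Q x = 0 \<and> (quadric_form P Q has_derivative (\<lambda>_. 0)) (at x))"

definition strict_transform :: "camera \<times> camera \<Rightarrow> camera \<times> camera \<Rightarrow> bpoint set"
  where "strict_transform P Q = blowup P \<inter> zclosure bvecs
    {z \<in> blowup P. blowdown z \<in> quadric P Q - {center (fst P), center (snd P)}}"

text \<open>Tangent space at \<open>z\<close> of the affine cone defined by the equations \<open>E\<close>.\<close>

definition tangent_space :: "(bvec \<Rightarrow> complex) set \<Rightarrow> bvec \<Rightarrow> bvec set"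
  where "tangent_space E z = {h. \<forall>f\<in>E. frechet_derivative f (at z) h = 0}"

text \<open>Jacobian criterion for the strict transform: at each of its points, the differential of its
  equation \<open>F\<^sub>Q(P\<^sub>1(z), P\<^sub>2(z)) = 0\<close> on the blow-up does not vanish on the tangent space of the
  (smooth) blow-up.

  Pitfall: this is smoothness with respect to the equation. If \<open>S\<^sub>P\<close> is singular at a center
  \<open>p\<^sub>i\<close>, the equation also vanishes on the exceptional divisor over \<open>p\<^sub>i\<close>, and the points where the
  strict transform meets that divisor count as singular, although for a cone with vertex \<open>p\<^sub>i\<close> the
  closure is itself a smooth surface. Similarly a double plane counts as singular.
  In these cases the first projection from \<open>incidence P Q\<close> below is in fact not injective.\<close>

definition strict_transform_smooth :: "camera \<times> camera \<Rightarrow> camera \<times> camera \<Rightarrow> bool"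
  where "strict_transform_smooth P Q \<longleftrightarrow>
    (\<forall>z \<in> strict_transform P Q. \<forall>w \<in> bvecs z. \<exists>h \<in> tangent_space (blowup_eqs P) w.
       frechet_derivative (\<lambda>(x, u, v). fund_form Q u v) (at w) h \<noteq> 0)"


section \<open>Epipolar lines and conjugate points\<close>

definition epi_line1 :: "camera \<times> camera \<Rightarrow> camera \<times> camera \<Rightarrow> bpoint set"
  where "epi_line1 P Q = {z \<in> blowup P. cam1 z = picture (fst Q) (center (snd Q))}"

definition epi_line2 :: "camera \<times> camera \<Rightarrow> camera \<times> camera \<Rightarrow> bpoint set"
  where "epi_line2 P Q = {z \<in> blowup P. cam2 z = picture (snd Q) (center (fst Q))}"

definition incidence :: "camera \<times> camera \<Rightarrow> camera \<times> camera \<Rightarrow> (bpoint \<times> bpoint) set"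
  where "incidence P Q = {(x, y). x \<in> strict_transform P Q \<and> y \<in> strict_transform Q P \<and>
    joint_camera_map x = joint_camera_map y}"

text \<open>The map to the conjugate point is defined where there is exactly one conjugate point.\<close>

definition psi_domain :: "camera \<times> camera \<Rightarrow> camera \<times> camera \<Rightarrow> bpoint set"
  where "psi_domain P Q = {x \<in> strict_transform P Q. \<exists>!y. (x, y) \<in> incidence P Q}"

definition psi :: "camera \<times> camera \<Rightarrow> camera \<times> camera \<Rightarrow> bpoint \<Rightarrow> bpoint"
  where "psi P Q x = (THE y. (x, y) \<in> incidence P Q)"

text \<open>Conjugates of a point of \<open>S\<^sub>P\<close>, as points of \<open>S\<^sub>Q\<close>.\<close>

definition down_conjugates :: "camera \<times> camera \<Rightarrow> camera \<times> camera \<Rightarrow> 4 proj \<Rightarrow> 4 proj set"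
  where "down_conjugates P Q X = {blowdown y | x y. (x, y) \<in> incidence P Q \<and> blowdown x = X}"

end

(*
  A point x of the strict transform with image (u, v) in P^2 x P^2 satisfies F_P(u, v) = F_Q(u, v) = 0,
  and a point y is conjugate to it only if y lies on both back-projected rays Q_1^-1(u), Q_2^-1(v).
  These rays meet in a single point, a bilinear expression in (u, v), unless both are the baseline
  q_1 q_2, that is, unless (u, v) is the pair of epipoles of Q.  If y is not a center, it lies on S_Q
  because F_P(u, v) = 0.  In general, the points whose images avoid the epipoles of both pairs are
  dense in the strict transform, and triangulation is polynomial near (u, v), so y still lies in the
  strict transform of S_Q.  The equation F_Q(u, v) = 0 is critical at the pair of epipoles of Q, so a
  smooth strict transform contains no point over it.  Finally, at a critical point x of S_P either
  P_1 x, P_2 x are multiples of the epipoles of Q, or (F_Q(., P_2 x), F_Q(P_1 x, .)) is a nonzero row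
  vector that annihilates the matrix defining F_P at these epipoles; in both cases F_P vanishes at
  them, which says that S_Q contains the baseline of Q.
*)
theory Submission
  imports Defs
begin

section \<open>Points of projective space and kernels of cameras\<close>

text \<open>The obstacle is that a strict transform is a Zariski closure: over the centers,
  membership is known only through polynomials that vanish off the centers. The quadric may also be
  reducible, so density of an open subset cannot be read off from irreducibility. Each point
  therefore receives its own curve, a line or a conic inside the quadric, which meets the four loci
  with an epipole as image for only finitely many parameters. A polynomial vanishing at the generic
  points vanishes along the curve by continuity, hence at the point itself. Generic points avoid the
  epipoles of both pairs, which makes the notion symmetric in P and Q; conjugation is then a
  bijection between the two generic sets, and these serve as the isomorphic dense open subsets.
  Polynomials here need not be homogeneous, so it matters at which coordinate vector they are
  evaluated; this explains the normalizing scalars in front of curves and triangulated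
  points.\<close>

lemma span_single: "vec.span {a} = {c *s a |c. True}" for a :: "'a::field^'n"
  by (auto simp: vec.span_singleton)

lemma dim_span_single: "a \<noteq> 0 \<Longrightarrow> vec.dim (vec.span {a}) = 1" for a :: "'a::field^'n"
  using vec.dim_eq_card_independent[of "{a}"] by (simp add: vec.dim_span)

lemma Rep_proj_span:
  assumes "v \<in> hvecs p"
  shows "Rep_proj p = vec.span {v}"
proof -
  have v: "v \<in> Rep_proj p" "v \<noteq> 0"
    using assms by (auto simp: hvecs_def)
  have p: "vec.subspace (Rep_proj p)" "vec.dim (Rep_proj p) = 1"
    using Rep_proj[of p] by auto
  have "vec.span {v} \<subseteq> Rep_proj p"
    using v p by (intro vec.span_minimal) auto
  then show ?thesis
    using v p dim_span_single[of v]
    by (metis vec.subspace_dim_equal vec.subspace_span order_refl)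
qed

lemma hvecs_nonempty: "\<exists>v. v \<in> hvecs p"
proof (rule ccontr)
  assume "\<nexists>v. v \<in> hvecs p"
  then have "Rep_proj p \<subseteq> {0}"
    by (auto simp: hvecs_def)
  then have "vec.dim (Rep_proj p) = 0"
    by (simp add: vec.dim_eq_0)
  moreover have "vec.dim (Rep_proj p) = 1"
    using Rep_proj[of p] by blast
  ultimately show False
    by linarith
qed

lemma hvecs_nonzero: "v \<in> hvecs p \<Longrightarrow> v \<noteq> 0"
  by (simp add: hvecs_def)

lemma hvecs_iff:
  assumes "v \<in> hvecs p"
  shows "w \<in> hvecs p \<longleftrightarrow> (\<exists>c. c \<noteq> 0 \<and> w = c *s v)"
proof -
  have "w \<in> hvecs p \<longleftrightarrow> w \<in> vec.span {v} \<and> w \<noteq> 0"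
    unfolding hvecs_def Rep_proj_span[OF assms] by auto
  then show ?thesis
    using hvecs_nonzero[OF assms] by (auto simp: span_single)
qed

lemma hvecs_cong: "v \<in> hvecs p \<Longrightarrow> v \<in> hvecs q \<Longrightarrow> p = q"
  using Rep_proj_span by (metis Rep_proj_inject)

lemma hvecs_ex: "v \<noteq> 0 \<Longrightarrow> \<exists>p. v \<in> hvecs p"
  by (rule exI[of _ "Abs_proj (vec.span {v})"])
    (auto simp: hvecs_def Abs_proj_inverse dim_span_single vec.span_base)

lemma hvecs_scale: "v \<in> hvecs p \<Longrightarrow> c \<noteq> 0 \<Longrightarrow> c *s v \<in> hvecs p"
  using hvecs_iff by blast

lemma hvecs_proportional:
  assumes "v \<in> hvecs p" "w \<in> hvecs q"
  shows "p = q \<longleftrightarrow> (\<exists>c. v = c *s w)"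
proof
  assume "p = q"
  then show "\<exists>c. v = c *s w"
    using assms hvecs_iff by blast
next
  assume "\<exists>c. v = c *s w"
  then obtain c where c: "v = c *s w" by blast
  then have "c \<noteq> 0"
    using assms(1) hvecs_nonzero by force
  then show "p = q"
    using assms c hvecs_cong hvecs_scale by metis
qed

text \<open>These determinants play two roles: they turn proportionality into polynomial equations,
  and they are the Cramer determinants of triangulation.\<close>

definition minor :: "'n \<Rightarrow> 'n \<Rightarrow> 'a::comm_ring^'n \<Rightarrow> 'a^'n \<Rightarrow> 'a"
  where "minor i j v w = v $ i * w $ j - v $ j * w $ i"

lemma minor_add_left: "minor i j (v + v') w = minor i j v w + minor i j v' w"
  and minor_scale_left: "minor i j (c *s v) w = c * minor i j v w"
  and minor_add_right: "minor i j w (v + v') = minor i j w v + minor i j w v'"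
  and minor_scale_right: "minor i j w (c *s v) = c * minor i j w v"
  and minor_self: "minor i j v v = 0"
  by (auto simp: minor_def algebra_simps)

lemma minors_zero_iff:
  fixes v w :: "'a::field^'n"
  assumes "w \<noteq> 0"
  shows "(\<forall>i j. minor i j v w = 0) \<longleftrightarrow> (\<exists>c. v = c *s w)"
proof
  assume *: "\<forall>i j. minor i j v w = 0"
  obtain k where k: "w $ k \<noteq> 0"
    using assms by (auto simp: vec_eq_iff)
  have "v = (v $ k / w $ k) *s w"
    using * k by (auto simp: vec_eq_iff minor_def field_simps)
  then show "\<exists>c. v = c *s w" ..
qed (auto simp: minor_scale_left minor_self)

text \<open>The kernel is the orthogonal complement of the row space, so its dimension is 4 - 3 = 1.
  The argument uses the real inner product, hence the detour over the reals.\<close>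

lemma rank3_kernel:
  fixes C :: camera
  assumes "is_camera C"
  obtains a where "a \<noteq> 0" "\<And>x. C *v x = 0 \<longleftrightarrow> (\<exists>c. x = c *\<^sub>R a)"
proof -
  have r: "dim (rows C) = 3"
    using assms by (simp add: is_camera_def row_rank_def)
  let ?K = "{x. \<forall>y\<in>span (rows C). orthogonal x y}"
  have K: "C *v x = 0 \<longleftrightarrow> x \<in> ?K" for x
  proof
    assume "C *v x = 0"
    then show "x \<in> ?K"
      using orthogonal_nullspace_rowspace orthogonal_commute by blast
  next
    assume "x \<in> ?K"
    then have "orthogonal x (C $ i)" for i
      by (auto intro!: span_base simp: rows_def row_def vec_lambda_eta)
    then show "C *v x = 0"
      by (simp add: matrix_mult_dot vec_eq_iff orthogonal_def inner_commute)
  qed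
  have "dim ?K + dim (span (rows C)) = dim (UNIV :: (real^4) set)"
    using dim_subspace_orthogonal_to_vectors[of "span (rows C)" UNIV]
    by (simp add: orthogonal_commute)
  then have "dim ?K = 1"
    using r by simp
  then obtain a where a: "a \<in> ?K" "a \<noteq> 0"
    by (metis (no_types, lifting) dim_eq_0 subsetI singleton_iff zero_neq_one)
  have "subspace ?K"
    by (auto simp: subspace_def orthogonal_def inner_add_left)
  moreover have "dim (span {a}) = 1"
    using a by simp
  moreover have "span {a} \<subseteq> ?K"
    using a \<open>subspace ?K\<close> by (intro span_minimal) auto
  ultimately have "span {a} = ?K"
    using \<open>dim ?K = 1\<close> by (intro subspace_dim_equal) auto
  then have "C *v x = 0 \<longleftrightarrow> x \<in> span {a}" for x
    using K by simp
  then show thesis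
    using that[of a] a by (auto simp: span_singleton)
qed

definition cvec :: "real^'n \<Rightarrow> complex^'n"
  where "cvec x = (\<chi> i. complex_of_real (x $ i))"

text \<open>Since the matrix is real, real and imaginary parts of a complex kernel vector are real
  kernel vectors, thus real multiples c and d of one generator; the complex multiple is c + i
  d.\<close>

lemma camera_kernel:
  assumes "is_camera C"
  obtains a where "a \<noteq> 0" "\<And>x. cmat C *v x = 0 \<longleftrightarrow> (\<exists>c. x = c *s a)"
proof -
  obtain a where a: "a \<noteq> 0" "\<And>x. C *v x = 0 \<longleftrightarrow> (\<exists>c. x = c *\<^sub>R a)"
    using rank3_kernel[OF assms] by metis
  have re: "C *v (\<chi> i. Re (x $ i)) = (\<chi> i. Re ((cmat C *v x) $ i))"
    and im: "C *v (\<chi> i. Im (x $ i)) = (\<chi> i. Im ((cmat C *v x) $ i))" for x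
    by (simp_all add: cmat_def matrix_vector_mult_def vec_eq_iff)
  show thesis
  proof
    show "cvec a \<noteq> 0"
      using a by (simp add: cvec_def vec_eq_iff)
    fix x
    show "cmat C *v x = 0 \<longleftrightarrow> (\<exists>c. x = c *s cvec a)"
    proof
      assume "cmat C *v x = 0"
      then have "C *v (\<chi> i. Re (x $ i)) = 0" "C *v (\<chi> i. Im (x $ i)) = 0"
        unfolding re im by (simp_all add: vec_eq_iff)
      then obtain c d where "(\<chi> i. Re (x $ i)) = c *\<^sub>R a" "(\<chi> i. Im (x $ i)) = d *\<^sub>R a"
        using a by metis
      then have "x = Complex c d *s cvec a"
        by (simp add: vec_eq_iff cvec_def complex_eq_iff)
      then show "\<exists>c. x = c *s cvec a" ..
    next
      have "C *v a = 0"
        using a(2)[of a] by (metis scaleR_one)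
      then have "C *v (\<chi> i. Re (cvec a $ i)) = 0" "C *v (\<chi> i. Im (cvec a $ i)) = 0"
        by (simp_all add: cvec_def vec_lambda_eta zero_vec_def[symmetric])
      then have "cmat C *v cvec a = 0"
        unfolding re im by (simp add: vec_eq_iff complex_eq_iff)
      moreover assume "\<exists>c. x = c *s cvec a"
      ultimately show "cmat C *v x = 0"
        by (auto simp: vector_scalar_commute)
    qed
  qed
qed

text \<open>Full rank makes the real map surjective, and a real right inverse remains one over the
  complex numbers.\<close>

lemma camera_right_inverse:
  assumes "is_camera C"
  obtains R where "cmat C ** R = mat 1"
proof -
  have "surj ((*v) C)"
    using assms full_rank_surjective[of C] by (simp add: is_camera_def)
  then obtain R :: "real^3^4" where R: "C ** R = mat 1"
    using matrix_right_invertible_surjective[of C] by auto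
  have "cmat C ** (\<chi> i j. complex_of_real (R $ i $ j)) = mat 1"
    using R by (simp add: cmat_def matrix_matrix_mult_def mat_def vec_eq_iff
        flip: of_real_mult of_real_sum)
  then show thesis by (rule that)
qed

section \<open>Polynomial maps and Zariski closed sets\<close>

lemma polyfun_sum:
  assumes "\<And>i. i \<in> I \<Longrightarrow> f i \<in> polyfun"
  shows "(\<lambda>v. \<Sum>i\<in>I. f i v) \<in> polyfun"
proof (cases "finite I")
  case True
  then show ?thesis
    using assms by (induction I rule: finite_induct) (auto intro: polyfun.intros)
qed (auto intro: polyfun.intros)

lemma polyfun_diff:
  assumes "f \<in> polyfun" "g \<in> polyfun"
  shows "(\<lambda>v. f v - g v) \<in> polyfun"
  using polyfun.add[OF assms(1) polyfun.mult[OF polyfun.const[of "-1"] assms(2)]] by simp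

text \<open>This is the condition on the local formula in \<open>regular_map\<close>, isolated to
  get closure under composition and the usual operations.\<close>

definition polymap :: "('a::coord_space \<Rightarrow> 'b::coord_space) \<Rightarrow> bool"
  where "polymap G \<longleftrightarrow> (\<forall>c\<in>coord_fun. (\<lambda>v. c (G v)) \<in> polyfun)"

lemma polyfun_compose:
  assumes "f \<in> polyfun" "polymap G"
  shows "(\<lambda>v. f (G v)) \<in> polyfun"
  using assms by (induction rule: polyfun.induct) (auto intro: polyfun.intros simp: polymap_def)

lemma polymap_compose:
  assumes "polymap T" "polymap G"
  shows "polymap (\<lambda>v. T (G v))"
  unfolding polymap_def
proof
  fix c :: "'b \<Rightarrow> complex" assume "c \<in> coord_fun"
  then have "(\<lambda>v. c (T v)) \<in> polyfun"
    using assms(1) by (simp add: polymap_def)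
  then show "(\<lambda>v. c (T (G v))) \<in> polyfun"
    using polyfun_compose[OF _ assms(2)] by blast
qed

lemma polymap_id: "polymap (\<lambda>v. v)"
  by (auto simp: polymap_def intro: polyfun.intros)

lemma polymap_complex: "polymap (f :: 'a::coord_space \<Rightarrow> complex) \<longleftrightarrow> f \<in> polyfun"
  by (simp add: polymap_def coord_fun_complex_def)

lemma polymap_vec: "polymap (G :: 'a::coord_space \<Rightarrow> 'b::coord_space^'n) \<longleftrightarrow> (\<forall>i. polymap (\<lambda>v. G v $ i))"
  by (auto simp: polymap_def coord_fun_vec_def)

lemma polymap_Pair: "polymap (\<lambda>v. (g v, h v)) \<longleftrightarrow> polymap g \<and> polymap h"
  by (auto simp: polymap_def coord_fun_prod_def ball_Un)

lemma polymap_fst: "polymap g \<Longrightarrow> polymap (\<lambda>v. fst (g v))"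
  and polymap_snd: "polymap g \<Longrightarrow> polymap (\<lambda>v. snd (g v))"
  by (auto simp: polymap_def coord_fun_prod_def)

lemma polymap_component:
  fixes g :: "'a::coord_space \<Rightarrow> complex^'n"
  shows "polymap g \<Longrightarrow> (\<lambda>v. g v $ i) \<in> polyfun"
  by (simp add: polymap_vec polymap_complex)

lemma polymap_smult:
  fixes g :: "'a::coord_space \<Rightarrow> complex^'n"
  shows "f \<in> polyfun \<Longrightarrow> polymap g \<Longrightarrow> polymap (\<lambda>v. f v *s g v)"
  by (auto simp: polymap_vec polymap_complex intro: polyfun.mult)

lemma polymap_add:
  fixes g h :: "'a::coord_space \<Rightarrow> complex^'n"
  shows "polymap g \<Longrightarrow> polymap h \<Longrightarrow> polymap (\<lambda>v. g v + h v)"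
  by (auto simp: polymap_vec polymap_complex intro: polyfun.add)

lemma polymap_const: "polymap (\<lambda>v. w)" for w :: "complex^'n"
  by (auto simp: polymap_vec polymap_complex intro: polyfun.const)

lemma polymap_matrix:
  fixes g :: "'a::coord_space \<Rightarrow> complex^'n"
  shows "polymap g \<Longrightarrow> polymap (\<lambda>v. A *v g v)"
  by (auto simp: polymap_vec polymap_complex matrix_vector_mult_def
      intro!: polyfun_sum polyfun.mult polyfun.const)

lemma polyfun_minor:
  fixes g h :: "'a::coord_space \<Rightarrow> complex^'n"
  shows "polymap g \<Longrightarrow> polymap h \<Longrightarrow> (\<lambda>v. minor i j (g v) (h v)) \<in> polyfun"
  by (auto simp: minor_def intro!: polyfun_diff polyfun.mult polymap_component)

lemmas polymap_intros = polymap_smult polymap_add polymap_const polymap_matrix polyfun_minor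
  polymap_component polymap_id polymap_fst polymap_snd polymap_Pair[THEN iffD2] conjI

text \<open>Continuity in the Euclidean topology allows Zariski density to be proved by limits along
  curves.\<close>

lemma continuous_on_polyfun_bvec:
  fixes f :: "bvec \<Rightarrow> complex"
  assumes "f \<in> polyfun"
  shows "continuous_on UNIV f"
  using assms
proof (induction rule: polyfun.induct)
  case (coord f)
  then show ?case
    by (auto simp: coord_fun_prod_def coord_fun_vec_def coord_fun_complex_def
        intro!: continuous_intros)
qed (auto intro!: continuous_intros)

text \<open>Every closed set is an intersection of zero loci of single polynomials, so it suffices
  to test one polynomial at a time. This is the working form of closure throughout.\<close>

lemma in_zclosure_iff:
  "p \<in> zclosure R A \<longleftrightarrow>
    (\<forall>f\<in>polyfun. (\<forall>q\<in>A. \<forall>v\<in>R q. f v = 0) \<longrightarrow> (\<forall>v\<in>R p. f v = 0))" (is "?l = ?r")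
proof
  assume l: ?l
  show ?r
  proof (intro ballI impI)
    fix f v assume f: "f \<in> polyfun" "\<forall>q\<in>A. \<forall>v\<in>R q. f v = 0" and v: "v \<in> R p"
    have "zclosed R (zero_locus R {f})" "A \<subseteq> zero_locus R {f}"
      using f by (auto simp: zclosed_def zero_locus_def)
    then have "p \<in> zero_locus R {f}"
      using l unfolding zclosure_def by blast
    then show "f v = 0"
      using v by (simp add: zero_locus_def)
  qed
next
  assume r: ?r
  show ?l
    unfolding zclosure_def zclosed_def
  proof safe
    fix F assume "A \<subseteq> zero_locus R F" "F \<subseteq> polyfun"
    with r show "p \<in> zero_locus R F"
      unfolding zero_locus_def by blast
  qed
qed

lemma zclosed_empty:
  assumes "\<And>p. R p \<noteq> {}"
  shows "zclosed R {}"
proof -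
  have "zero_locus R {\<lambda>_. 1} = {}"
    unfolding zero_locus_def using assms by simp
  then show ?thesis
    unfolding zclosed_def using polyfun.const by (metis empty_subsetI insert_subset)
qed

lemma zclosureD:
  assumes "p \<in> zclosure R A" "f \<in> polyfun" "\<And>q v. q \<in> A \<Longrightarrow> v \<in> R q \<Longrightarrow> f v = 0" "v \<in> R p"
  shows "f v = 0"
  using assms unfolding in_zclosure_iff by blast

lemma zclosure_superset: "A \<subseteq> zclosure R A"
  by (auto simp: zclosure_def)

lemma zclosure_mono: "A \<subseteq> B \<Longrightarrow> zclosure R A \<subseteq> zclosure R B"
  by (auto simp: zclosure_def)

lemma zclosure_minimal: "A \<subseteq> zclosure R B \<Longrightarrow> zclosure R A \<subseteq> zclosure R B"
  unfolding subset_iff in_zclosure_iff[of _ R B] in_zclosure_iff[of _ R A] by blast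

lemma zero_locusD: "p \<in> zero_locus R F \<Longrightarrow> f \<in> F \<Longrightarrow> v \<in> R p \<Longrightarrow> f v = 0"
  by (simp add: zero_locus_def)

lemma not_in_zero_locus_iff: "p \<notin> zero_locus R F \<longleftrightarrow> (\<exists>f\<in>F. \<exists>v\<in>R p. f v \<noteq> 0)"
  by (auto simp: zero_locus_def)

text \<open>For equations that are not homogeneous, the products of equations of two sets need not define
  their union: the factors may vanish at different coordinate vectors of the same point.\<close>

definition zero_homogeneous :: "('p \<Rightarrow> 'v set) \<Rightarrow> ('v \<Rightarrow> complex) \<Rightarrow> bool"
  where "zero_homogeneous R f \<longleftrightarrow> (\<forall>p. \<forall>v\<in>R p. \<forall>w\<in>R p. f v = 0 \<longrightarrow> f w = 0)"

definition hclosed :: "('p \<Rightarrow> 'v::coord_space set) \<Rightarrow> 'p set \<Rightarrow> bool"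
  where "hclosed R Z \<longleftrightarrow> (\<exists>F. F \<subseteq> polyfun \<and> Z = zero_locus R F \<and> (\<forall>f\<in>F. zero_homogeneous R f))"

lemma hclosedE:
  assumes "hclosed R Z"
  obtains F where "F \<subseteq> polyfun" "Z = zero_locus R F" "\<And>f. f \<in> F \<Longrightarrow> zero_homogeneous R f"
  using assms unfolding hclosed_def by blast

lemma hclosed_imp_zclosed: "hclosed R Z \<Longrightarrow> zclosed R Z"
  unfolding hclosed_def zclosed_def by blast

lemma hclosed_Int:
  assumes "hclosed R Z" "hclosed R W"
  shows "hclosed R (Z \<inter> W)"
proof -
  obtain F where F: "F \<subseteq> polyfun" "Z = zero_locus R F" "\<And>f. f \<in> F \<Longrightarrow> zero_homogeneous R f"
    using assms(1) by (elim hclosedE) blast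
  obtain G where G: "G \<subseteq> polyfun" "W = zero_locus R G" "\<And>f. f \<in> G \<Longrightarrow> zero_homogeneous R f"
    using assms(2) by (elim hclosedE) blast
  have "Z \<inter> W = zero_locus R (F \<union> G)"
    unfolding F(2) G(2) zero_locus_def by blast
  then show ?thesis
    unfolding hclosed_def using F G by (intro exI[of _ "F \<union> G"]) auto
qed

lemma hclosed_Un:
  assumes "hclosed R Z" "hclosed R W"
  shows "hclosed R (Z \<union> W)"
proof -
  obtain F where F: "F \<subseteq> polyfun" "Z = zero_locus R F" "\<And>f. f \<in> F \<Longrightarrow> zero_homogeneous R f"
    using assms(1) by (elim hclosedE) blast
  obtain G where G: "G \<subseteq> polyfun" "W = zero_locus R G" "\<And>f. f \<in> G \<Longrightarrow> zero_homogeneous R f"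
    using assms(2) by (elim hclosedE) blast
  let ?H = "(\<lambda>(f, g) v. f v * g v) ` (F \<times> G)"
  have "zero_locus R ?H \<subseteq> Z \<union> W"
  proof
    fix p assume p: "p \<in> zero_locus R ?H"
    show "p \<in> Z \<union> W"
    proof (rule ccontr)
      assume "p \<notin> Z \<union> W"
      then have "p \<notin> zero_locus R F" "p \<notin> zero_locus R G"
        unfolding F(2) G(2) by simp_all
      then obtain f v g w where *: "f \<in> F" "v \<in> R p" "f v \<noteq> 0" "g \<in> G" "w \<in> R p" "g w \<noteq> 0"
        unfolding not_in_zero_locus_iff by metis
      \<comment> \<open>Homogeneity moves the nonvanishing of g from w to v, the coordinate vector
        at which f is known to be nonzero.\<close>
      then have "g v \<noteq> 0"
        using G(3)[OF *(4)] unfolding zero_homogeneous_def by blast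
      moreover have "f v * g v = 0"
        using zero_locusD[OF p, of "\<lambda>v. f v * g v" v] * by force
      ultimately show False
        using * by simp
    qed
  qed
  moreover have "Z \<union> W \<subseteq> zero_locus R ?H"
    unfolding F(2) G(2) zero_locus_def by auto
  ultimately have "Z \<union> W = zero_locus R ?H" by blast
  moreover have "?H \<subseteq> polyfun"
    using F(1) G(1) by (auto intro: polyfun.mult)
  moreover have "zero_homogeneous R h" if "h \<in> ?H" for h
  proof -
    from that obtain f g where h: "h = (\<lambda>v. f v * g v)" and "f \<in> F" "g \<in> G" by auto
    then have "zero_homogeneous R f" "zero_homogeneous R g"
      using F(3) G(3) by auto
    then show ?thesis
      unfolding h zero_homogeneous_def mult_eq_0_iff by blast
  qed
  ultimately show ?thesis
    unfolding hclosed_def by blast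
qed

section \<open>Restriction and congruence of regular maps\<close>

lemma regular_map_subset:
  assumes "regular_map R S X Y f" "X' \<subseteq> X" "f ` X' \<subseteq> Y'"
  shows "regular_map R S X' Y' f"
  unfolding regular_map_def
proof (intro conjI ballI)
  fix p assume "p \<in> X'"
  then obtain Z G where "zclosed R Z" "p \<notin> Z" "\<forall>c\<in>coord_fun. (\<lambda>v. c (G v)) \<in> polyfun"
      "\<forall>q\<in>X - Z. \<forall>v\<in>R q. G v \<in> S (f q)"
    using assms unfolding regular_map_def by blast
  then show "\<exists>Z G. zclosed R Z \<and> p \<notin> Z \<and> (\<forall>c\<in>coord_fun. (\<lambda>v. c (G v)) \<in> polyfun) \<and>
       (\<forall>q\<in>X' - Z. \<forall>v\<in>R q. G v \<in> S (f q))"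
    using assms(2) by (intro exI[of _ Z] exI[of _ G]) blast
qed (use assms in auto)

lemma regular_map_cong:
  assumes "regular_map R S X Y f" "\<And>x. x \<in> X \<Longrightarrow> f x = g x"
  shows "regular_map R S X Y g"
proof -
  have "f ` X = g ` X"
    using assms(2) by (rule image_cong[OF refl])
  moreover have "(\<forall>q\<in>X - Z. \<forall>v\<in>R q. G v \<in> S (f q)) \<longleftrightarrow> (\<forall>q\<in>X - Z. \<forall>v\<in>R q. G v \<in> S (g q))" for Z G
    using assms(2) by simp
  ultimately show ?thesis
    using assms(1) unfolding regular_map_def by simp
qed

section \<open>The fundamental form and triangulation\<close>

lemma sum_UNIV_Plus: "sum f (UNIV :: ('a::finite + 'b::finite) set) = (\<Sum>i\<in>UNIV. f (Inl i)) + (\<Sum>i\<in>UNIV. f (Inr i))"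
  by (simp add: UNIV_Plus_UNIV[symmetric] sum.Plus del: UNIV_Plus_UNIV)

lemma det_zero_iff_kernel: "det M = 0 \<longleftrightarrow> (\<exists>w. w \<noteq> 0 \<and> M *v w = 0)" for M :: "'a::field^'n^'n"
  using invertible_det_nz[of M] invertible_left_inverse[of M] matrix_left_invertible_ker[of M] by blast

definition fund_matrix :: "camera \<times> camera \<Rightarrow> complex^3 \<Rightarrow> complex^3 \<Rightarrow> complex^(3+3)^(3+3)"
  where "fund_matrix P u v = (\<chi> i. case i of
      Inl k \<Rightarrow> block_row (cmat (fst P) $ k) (u $ k) 0
    | Inr k \<Rightarrow> block_row (cmat (snd P) $ k) 0 (v $ k))"

text \<open>The vector (x, s, t) in the column order of \<open>block_row\<close>, so that a product
  with the 6 x 6 matrix splits into one equation for each camera.\<close>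

definition block_vec :: "complex^4 \<Rightarrow> complex \<Rightarrow> complex \<Rightarrow> complex^(3+3)"
  where "block_vec x s t = (\<chi> j. case j of
      Inl k \<Rightarrow> if k = 1 then x $ 1 else if k = 2 then x $ 2 else x $ 3
    | Inr k \<Rightarrow> if k = 1 then x $ 4 else if k = 2 then s else t)"

lemma fund_form_det: "fund_form P u v = det (fund_matrix P u v)"
  by (simp add: fund_form_def fund_matrix_def)

lemma all_sum_3_3: "(\<forall>j :: 3 + 3. \<phi> j) \<longleftrightarrow>
    \<phi> (Inl 1) \<and> \<phi> (Inl 2) \<and> \<phi> (Inl 3) \<and> \<phi> (Inr 1) \<and> \<phi> (Inr 2) \<and> \<phi> (Inr 3)"
  by (simp add: split_sum_all forall_3)

lemma block_vec_surj: "\<exists>x s t. w = block_vec x s t"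
  by (rule exI[of _ "\<chi> i. if i = 1 then w $ Inl 1 else if i = 2 then w $ Inl 2 else if i = 3 then w $ Inl 3 else w $ Inr 1"],
      rule exI[of _ "w $ Inr 2"], rule exI[of _ "w $ Inr 3"])
    (simp add: vec_eq_iff all_sum_3_3 block_vec_def)

lemma block_vec_eq_0: "block_vec x s t = 0 \<longleftrightarrow> x = 0 \<and> s = 0 \<and> t = 0"
  by (auto simp: vec_eq_iff all_sum_3_3 forall_4 block_vec_def)

lemma fund_matrix_mult: "fund_matrix P u v *v block_vec x s t =
  (\<chi> i. case i of Inl k \<Rightarrow> (cmat (fst P) *v x + s *s u) $ k | Inr k \<Rightarrow> (cmat (snd P) *v x + t *s v) $ k)"
  by (auto simp: vec_eq_iff matrix_vector_mult_def sum_UNIV_Plus fund_matrix_def block_row_def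
      block_vec_def sum_3 sum_4 algebra_simps split: sum.split)

text \<open>A kernel vector of the 6 x 6 matrix consists of a vector x and two scalars whose signs
  can be absorbed. For nonzero u and v it amounts to a point of space on both back-projected
  rays.\<close>

lemma fund_form_eq_0_iff:
  "fund_form P u v = 0 \<longleftrightarrow>
    (\<exists>x s t. (x \<noteq> 0 \<or> s \<noteq> 0 \<or> t \<noteq> 0) \<and> cmat (fst P) *v x = s *s u \<and> cmat (snd P) *v x = t *s v)"
proof -
  have "fund_form P u v = 0 \<longleftrightarrow> (\<exists>x s t. block_vec x s t \<noteq> 0 \<and> fund_matrix P u v *v block_vec x s t = 0)"
    unfolding fund_form_det det_zero_iff_kernel by (metis block_vec_surj)
  also have "\<dots> \<longleftrightarrow> (\<exists>x s t. (x \<noteq> 0 \<or> s \<noteq> 0 \<or> t \<noteq> 0) \<and>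
      cmat (fst P) *v x = (- s) *s u \<and> cmat (snd P) *v x = (- t) *s v)"
    unfolding block_vec_eq_0 fund_matrix_mult
    by (auto simp: vec_eq_iff all_sum_3_3 forall_3 eq_neg_iff_add_eq_0)
  also have "\<dots> \<longleftrightarrow> (\<exists>x s t. (x \<noteq> 0 \<or> s \<noteq> 0 \<or> t \<noteq> 0) \<and>
      cmat (fst P) *v x = s *s u \<and> cmat (snd P) *v x = t *s v)"
    by (metis neg_equal_0_iff_equal minus_minus)
  finally show ?thesis .
qed

text \<open>The dual criterion: a nonzero row vector (l, m) annihilates the camera columns and the
  two columns (u, 0) and (0, v), so the matrix cannot be invertible. It is applied to the gradient
  at a critical point of the quadric.\<close>

lemma fund_form_eq_0I_left:
  assumes "l \<noteq> 0 \<or> m \<noteq> 0"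
    and "\<And>h. (\<Sum>k\<in>UNIV. l $ k * (cmat (fst P) *v h) $ k) + (\<Sum>k\<in>UNIV. m $ k * (cmat (snd P) *v h) $ k) = 0"
    and "(\<Sum>k\<in>UNIV. l $ k * u $ k) = 0" "(\<Sum>k\<in>UNIV. m $ k * v $ k) = 0"
  shows "fund_form P u v = 0"
proof (rule ccontr)
  assume "fund_form P u v \<noteq> 0"
  then obtain N where N: "fund_matrix P u v ** N = mat 1"
    unfolding fund_form_det by (metis invertible_det_nz invertible_right_inverse)
  define r :: "complex^(3+3)" where "r = (\<chi> i. case i of Inl k \<Rightarrow> l $ k | Inr k \<Rightarrow> m $ k)"
  have "(\<Sum>i\<in>UNIV. r $ i * (fund_matrix P u v *v w) $ i) = 0" for w
  proof -
    obtain x s t where w: "w = block_vec x s t"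
      using block_vec_surj by blast
    have "(\<Sum>i\<in>UNIV. r $ i * (fund_matrix P u v *v w) $ i) =
       ((\<Sum>k\<in>UNIV. l $ k * (cmat (fst P) *v x) $ k) + (\<Sum>k\<in>UNIV. m $ k * (cmat (snd P) *v x) $ k))
       + s * (\<Sum>k\<in>UNIV. l $ k * u $ k) + t * (\<Sum>k\<in>UNIV. m $ k * v $ k)"
      by (simp add: w fund_matrix_mult sum_UNIV_Plus r_def sum_3 algebra_simps)
    then show ?thesis
      using assms by simp
  qed
  from this[of "N *v _"] have "(\<Sum>i\<in>UNIV. r $ i * w $ i) = 0" for w
    by (simp add: matrix_vector_mul_assoc N)
  from this[of "axis _ 1"] have "r $ j = 0" for j
    by (simp add: axis_def if_distrib cong: if_cong)
  from this[of "Inl _"] this[of "Inr _"] have "l = 0" "m = 0"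
    by (simp_all add: r_def vec_eq_iff)
  then show False
    using assms(1) by simp
qed

section \<open>Bilinearity, derivative and polynomiality of the fundamental form\<close>

definition camera_columns :: "camera \<times> camera \<Rightarrow> complex^(3+3)^(3+3)"
  where "camera_columns P = transpose (fund_matrix P 0 0)"

text \<open>\<open>det_row_add\<close> and \<open>det_row_mul\<close> speak of rows, so the columns
  holding u and v are made rows. The outermost test singles out the row of u, the shape that these
  rules unify with.\<close>

lemma fund_matrix_transpose: "transpose (fund_matrix P u v) = (\<chi> j.
    if j = Inr 2 then (\<chi> i. case i of Inl k \<Rightarrow> u $ k | Inr k \<Rightarrow> 0)
    else if j = Inr 3 then (\<chi> i. case i of Inl k \<Rightarrow> 0 | Inr k \<Rightarrow> v $ k)
    else camera_columns P $ j)"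
  by (simp add: vec_eq_iff all_sum_3_3 transpose_def camera_columns_def fund_matrix_def block_row_def)

lemma fund_form_add_left: "fund_form P (u + u') v = fund_form P u v + fund_form P u' v"
  and fund_form_scale_left: "fund_form P (c *s u) v = c * fund_form P u v"
proof -
  let ?r = "\<lambda>u. (\<chi> i. case i of Inl k \<Rightarrow> u $ k | Inr k \<Rightarrow> 0) :: complex^(3+3)"
  have r: "?r (u + u') = ?r u + ?r u'" "?r (c *s u) = c *s ?r u"
    by (auto simp: vec_eq_iff split: sum.split)
  show "fund_form P (u + u') v = fund_form P u v + fund_form P u' v"
    unfolding fund_form_det det_transpose[of "fund_matrix _ _ _", symmetric] fund_matrix_transpose r
    by (rule det_row_add)
  show "fund_form P (c *s u) v = c * fund_form P u v"
    unfolding fund_form_det det_transpose[of "fund_matrix _ _ _", symmetric] fund_matrix_transpose r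
    by (rule det_row_mul)
qed

text \<open>The same matrix with the tests exchanged, to expose linearity in v.\<close>

lemma fund_matrix_transpose': "transpose (fund_matrix P u v) = (\<chi> j.
    if j = Inr 3 then (\<chi> i. case i of Inl k \<Rightarrow> 0 | Inr k \<Rightarrow> v $ k)
    else if j = Inr 2 then (\<chi> i. case i of Inl k \<Rightarrow> u $ k | Inr k \<Rightarrow> 0)
    else camera_columns P $ j)"
  by (simp add: vec_eq_iff all_sum_3_3 transpose_def camera_columns_def fund_matrix_def block_row_def)

lemma fund_form_add_right: "fund_form P u (v + v') = fund_form P u v + fund_form P u v'"
  and fund_form_scale_right: "fund_form P u (c *s v) = c * fund_form P u v"
proof -
  let ?r = "\<lambda>v. (\<chi> i. case i of Inl k \<Rightarrow> 0 | Inr k \<Rightarrow> v $ k) :: complex^(3+3)"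
  have r: "?r (v + v') = ?r v + ?r v'" "?r (c *s v) = c *s ?r v"
    by (auto simp: vec_eq_iff split: sum.split)
  show "fund_form P u (v + v') = fund_form P u v + fund_form P u v'"
    unfolding fund_form_det det_transpose[of "fund_matrix _ _ _", symmetric] fund_matrix_transpose' r
    by (rule det_row_add)
  show "fund_form P u (c *s v) = c * fund_form P u v"
    unfolding fund_form_det det_transpose[of "fund_matrix _ _ _", symmetric] fund_matrix_transpose' r
    by (rule det_row_mul)
qed

lemmas fund_form_bilinear = fund_form_add_left fund_form_add_right fund_form_scale_left fund_form_scale_right

lemma fund_form_linear_left: "fund_form P u v = (\<Sum>i\<in>UNIV. u $ i * fund_form P (axis i 1) v)"
proof -
  have "u = u $ 1 *s axis 1 1 + u $ 2 *s axis 2 1 + u $ 3 *s axis 3 1"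
    by (simp add: vec_eq_iff forall_3 axis_def)
  then have "fund_form P u v = fund_form P (u $ 1 *s axis 1 1 + u $ 2 *s axis 2 1 + u $ 3 *s axis 3 1) v"
    by simp
  then show ?thesis
    by (simp only: fund_form_bilinear sum_3)
qed

lemma fund_form_linear_right: "fund_form P u v = (\<Sum>j\<in>UNIV. fund_form P u (axis j 1) * v $ j)"
proof -
  have "v = v $ 1 *s axis 1 1 + v $ 2 *s axis 2 1 + v $ 3 *s axis 3 1"
    by (simp add: vec_eq_iff forall_3 axis_def)
  then have "fund_form P u v = fund_form P u (v $ 1 *s axis 1 1 + v $ 2 *s axis 2 1 + v $ 3 *s axis 3 1)"
    by simp
  then show ?thesis
    by (simp only: fund_form_bilinear sum_3 mult.commute)
qed

lemma fund_form_coords: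
  "fund_form P u v = (\<Sum>i\<in>UNIV. u $ i * (\<Sum>j\<in>UNIV. fund_form P (axis i 1) (axis j 1) * v $ j))"
  by (subst fund_form_linear_left, subst fund_form_linear_right) (rule refl)

lemma fund_form_has_derivative:
  assumes "(f has_derivative f') (at z)" "(g has_derivative g') (at z)"
  shows "((\<lambda>w. fund_form P (f w) (g w)) has_derivative
    (\<lambda>h. fund_form P (f' h) (g z) + fund_form P (f z) (g' h))) (at z)"
proof -
  have "((\<lambda>w. \<Sum>i\<in>UNIV. f w $ i * (\<Sum>j\<in>UNIV. fund_form P (axis i 1) (axis j 1) * g w $ j)) has_derivative
    (\<lambda>h. \<Sum>i\<in>UNIV. f z $ i * (\<Sum>j\<in>UNIV. fund_form P (axis i 1) (axis j 1) * g' h $ j)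
       + f' h $ i * (\<Sum>j\<in>UNIV. fund_form P (axis i 1) (axis j 1) * g z $ j))) (at z)"
    by (intro has_derivative_sum has_derivative_mult has_derivative_mult_right
        bounded_linear.has_derivative[OF bounded_linear_vec_nth] assms)
  then show ?thesis
    by (simp add: fund_form_coords[of P "f _"] fund_form_coords[of P "f' _"] sum.distrib add.commute)
qed

lemma polyfun_fund_form:
  assumes "polymap g" "polymap h"
  shows "(\<lambda>w. fund_form P (g w) (h w)) \<in> polyfun"
  unfolding fund_form_coords[of P "g _"]
  by (intro polyfun_sum polyfun.mult polyfun.const polymap_component assms)

text \<open>Two complex cameras with generators of their kernels. The right inverses select a point
  R u on each ray, so that the ray is spanned by R u and the center. Keeping the matrices abstract
  makes the exchange of the two cameras an instance of the same locale.\<close>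

locale camera_pair =
  fixes A B :: "complex^4^3" and a b :: "complex^4" and R S :: "complex^3^4"
  assumes ker_A: "\<And>x. A *v x = 0 \<longleftrightarrow> (\<exists>c. x = c *s a)"
    and ker_B: "\<And>x. B *v x = 0 \<longleftrightarrow> (\<exists>c. x = c *s b)"
    and right_inverse_A: "A ** R = mat 1"
    and right_inverse_B: "B ** S = mat 1"
    and nonzero: "a \<noteq> 0" "b \<noteq> 0"
    and independent: "\<And>c. b \<noteq> c *s a"
begin

lemma A_a: "A *v a = 0" and B_b: "B *v b = 0"
  using ker_A[of a] ker_B[of b] by (metis vec.scale_one)+

lemma A_R: "A *v (R *v u) = u" and B_S: "B *v (S *v u) = u"
  by (simp_all add: matrix_vector_mul_assoc right_inverse_A right_inverse_B)

lemma A_b_nonzero: "A *v b \<noteq> 0"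
  using ker_A independent by blast

lemma swap: "camera_pair B A b a S R"
proof
  fix c show "a \<noteq> c *s b"
  proof
    assume *: "a = c *s b"
    then have "b = (1 / c) *s a"
      using nonzero by (auto simp: vector_smult_assoc)
    then show False
      using independent by blast
  qed
qed (use ker_A ker_B right_inverse_A right_inverse_B nonzero in auto)

lemma B_a_nonzero: "B *v a \<noteq> 0"
  using camera_pair.A_b_nonzero[OF swap] .

lemma preimage_line:
  assumes "A *v x = s *s u"
  obtains r where "x = s *s (R *v u) + r *s a"
proof -
  have "A *v (x - s *s (R *v u)) = 0"
    using assms by (simp add: matrix_vector_mult_diff_distrib vector_scalar_commute A_R)
  then obtain r where "x - s *s (R *v u) = r *s a"
    using ker_A by blast
  then show thesis
    using that[of r] by (simp add: algebra_simps)
qed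

text \<open>A point s R u + r a of the first ray has second image s (B R u) + r (B a), to be
  proportional to v. Cramer's rule, in the coordinates i and j, gives these minors as the ratio of s
  to r. The result is linear in u and in v.\<close>

definition triangulate :: "3 \<Rightarrow> 3 \<Rightarrow> complex^3 \<Rightarrow> complex^3 \<Rightarrow> complex^4"
  where "triangulate i j u v =
    minor i j v (B *v a) *s (R *v u) + minor i j (B *v (R *v u)) v *s a"

text \<open>Insert t v = s (B R u) + r (B a) into the two minors: in each of them one summand drops
  out.\<close>

lemma triangulate:
  assumes "A *v x = s *s u" "B *v x = t *s v"
  shows "minor i j (B *v (R *v u)) (B *v a) *s x = t *s triangulate i j u v"
proof -
  obtain r where x: "x = s *s (R *v u) + r *s a"
    using preimage_line[OF assms(1)] .
  have v: "t *s v = s *s (B *v (R *v u)) + r *s (B *v a)"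
    using assms(2) by (simp add: x matrix_vector_right_distrib vector_scalar_commute)
  have "t * minor i j v (B *v a) = s * minor i j (B *v (R *v u)) (B *v a)"
    unfolding minor_scale_left[symmetric] v minor_add_left by (simp add: minor_scale_left minor_self)
  moreover have "t * minor i j (B *v (R *v u)) v = r * minor i j (B *v (R *v u)) (B *v a)"
    unfolding minor_scale_right[symmetric] v minor_add_right by (simp add: minor_scale_right minor_self)
  ultimately show ?thesis
    by (simp add: triangulate_def x vec.scale_right_distrib vector_smult_assoc mult.commute)
qed

text \<open>If all minors vanish, the point R u differs from some multiple of a by a vector in the
  kernel of B, thus by a multiple of b. Applying A shows that u is a multiple of the
  epipole.\<close>

lemma minor_nonzero:
  assumes "\<And>c. u \<noteq> c *s (A *v b)"
  obtains i j where "minor i j (B *v (R *v u)) (B *v a) \<noteq> 0"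
proof -
  have "\<nexists>c. B *v (R *v u) = c *s (B *v a)"
  proof
    assume "\<exists>c. B *v (R *v u) = c *s (B *v a)"
    then obtain c where "B *v (R *v u) = c *s (B *v a)" by blast
    then have "B *v (R *v u - c *s a) = 0"
      by (simp add: matrix_vector_mult_diff_distrib vector_scalar_commute)
    then obtain d where "R *v u - c *s a = d *s b"
      using ker_B by blast
    then have "A *v (R *v u - c *s a) = A *v (d *s b)" by simp
    then have "u = d *s (A *v b)"
      by (simp add: matrix_vector_mult_diff_distrib vector_scalar_commute A_R A_a)
    then show False
      using assms by blast
  qed
  then show thesis
    using minors_zero_iff[OF B_a_nonzero] that by blast
qed

text \<open>The second center is on the first ray only if u is the epipole, so here the second image
  of x is nonzero.\<close>

lemma scale_nonzero:
  assumes "x \<noteq> 0" "A *v x = s *s u" "B *v x = t *s v" "\<And>c. u \<noteq> c *s (A *v b)"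
  shows "t \<noteq> 0"
proof
  assume "t = 0"
  moreover obtain i j where "minor i j (B *v (R *v u)) (B *v a) \<noteq> 0"
    using minor_nonzero[OF assms(4)] by blast
  ultimately show False
    using triangulate[OF assms(2,3), of i j] assms(1) by simp
qed

lemma triangulate_proportional:
  assumes "x \<noteq> 0" "A *v x = s *s u" "B *v x = t *s v"
    and "minor i j (B *v (R *v u)) (B *v a) \<noteq> 0"
  obtains c where "c \<noteq> 0" "triangulate i j u v = c *s x"
proof -
  have *: "minor i j (B *v (R *v u)) (B *v a) *s x = t *s triangulate i j u v"
    by (rule triangulate[OF assms(2,3)])
  then have t: "t \<noteq> 0"
    using assms by auto
  then have "triangulate i j u v = (1 / t) *s (t *s triangulate i j u v)"
    by (simp add: vector_smult_assoc)
  also have "\<dots> = (minor i j (B *v (R *v u)) (B *v a) / t) *s x"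
    unfolding *[symmetric] by (simp add: vector_smult_assoc)
  finally show thesis
    using that[of "minor i j (B *v (R *v u)) (B *v a) / t"] t assms(4) by simp
qed

text \<open>Both points are multiples of the same triangulated vector, because its formula depends
  on u and v alone.\<close>

lemma unique_left:
  assumes "x \<noteq> 0" "A *v x = s *s u" "B *v x = t *s v"
    and "x' \<noteq> 0" "A *v x' = s' *s u" "B *v x' = t' *s v"
    and "\<And>c. u \<noteq> c *s (A *v b)"
  shows "\<exists>c. x' = c *s x"
proof -
  obtain i j where ij: "minor i j (B *v (R *v u)) (B *v a) \<noteq> 0"
    using minor_nonzero[OF assms(7)] by blast
  obtain c c' where "c \<noteq> 0" "triangulate i j u v = c *s x" "c' \<noteq> 0" "triangulate i j u v = c' *s x'"
    using triangulate_proportional[OF assms(1-3) ij] triangulate_proportional[OF assms(4-6) ij] by metis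
  then have "(1 / c') *s (c' *s x') = (1 / c') *s (c *s x)"
    by metis
  then show ?thesis
    using \<open>c' \<noteq> 0\<close> by (auto simp: vector_smult_assoc)
qed

lemma unique:
  assumes "x \<noteq> 0" "A *v x = s *s u" "B *v x = t *s v"
    and "x' \<noteq> 0" "A *v x' = s' *s u" "B *v x' = t' *s v"
    and "\<not> ((\<exists>c. u = c *s (A *v b)) \<and> (\<exists>c. v = c *s (B *v a)))"
  shows "\<exists>c. x' = c *s x"
  using unique_left[OF assms(1-6)] camera_pair.unique_left[OF swap assms(1,3,2,4,6,5)] assms(7) by metis

end

section \<open>Curves in quadrics\<close>

lemma subspace_scale_cancel:
  fixes L :: "('a::field^'n) set"
  assumes "vec.subspace L" "c \<noteq> 0" "c *s w \<in> L"
  shows "w \<in> L"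
  using vec.subspace_scale[OF assms(1,3), of "1 / c"] assms(2) by (simp add: vector_smult_assoc)

text \<open>The twisted cubic: a nonzero linear functional restricts to a nonzero polynomial of
  degree at most 3 in the parameter, so no proper subspace contains infinitely many of its
  points.\<close>

definition moment :: "complex \<Rightarrow> complex^4"
  where "moment t = (\<chi> i. if i = 1 then 1 else if i = 2 then t else if i = 3 then t ^ 2 else t ^ 3)"

lemma finite_moment_in_subspace:
  assumes "vec.subspace L" "L \<noteq> UNIV"
  shows "finite {t. moment t \<in> L}"
proof -
  obtain B where B: "B \<subseteq> L" "vec.independent B" "L \<subseteq> vec.span B"
    using vec.basis_exists[of L] by metis
  obtain y where y: "y \<notin> L"
    using assms(2) by blast
  have "vec.span B \<subseteq> L"
    using B(1) assms(1) by (rule vec.span_minimal)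
  then have yB: "y \<notin> vec.span B"
    using y by blast
  then have "vec.independent (insert y B)"
    using B(2) by (simp add: vec.independent_insert)
  \<comment> \<open>A functional that vanishes on L but not at y, encoded as the first coordinate of
    an endomorphism.\<close>
  then obtain g :: "complex^4 \<Rightarrow> complex^4" where g: "Vector_Spaces.linear (*s) (*s) g"
      "\<forall>x\<in>insert y B. g x = (if x = y then axis 1 1 else 0)"
    using vec.linear_independent_extend[of "insert y B" "\<lambda>x. if x = y then axis 1 1 else 0"] by blast
  have "y \<notin> B"
    using yB vec.span_base by blast
  then have gB: "g x = 0" if "x \<in> B" for x
    using g(2) that by auto
  have gL: "g x = 0" if "x \<in> L" for x
    using vec.linear_eq_0_on_span[OF g(1) gB] that B(3) by blast
  define c :: "nat \<Rightarrow> complex" where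
    "c k = g (axis (if k = 0 then 1 else if k = 1 then 2 else if k = 2 then 3 else 4) 1) $ 1" for k
  interpret g: Vector_Spaces.linear "(*s)" "(*s)" g by (rule g(1))
  have gx: "g x $ 1 = x $ 1 * c 0 + x $ 2 * c 1 + x $ 3 * c 2 + x $ 4 * c 3" for x
  proof -
    have "x = x $ 1 *s axis 1 1 + x $ 2 *s axis 2 1 + x $ 3 *s axis 3 1 + x $ 4 *s axis 4 1"
      by (simp add: vec_eq_iff forall_4 axis_def)
    then have "g x $ 1 = g (x $ 1 *s axis 1 1 + x $ 2 *s axis 2 1 + x $ 3 *s axis 3 1 + x $ 4 *s axis 4 1) $ 1"
      by simp
    then show ?thesis
      by (simp add: g.add g.scale c_def)
  qed
  have "g y $ 1 \<noteq> 0"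
    using g(2) by (simp add: axis_def)
  then obtain k where "k \<in> {0, 1, 2, 3}" "c k \<noteq> 0"
    unfolding gx by (metis add.right_neutral insertCI mult_zero_right)
  then have "k \<le> 3" by auto
  have "finite {t. (\<Sum>i\<le>3. c i * t ^ i) = 0}"
    using \<open>c k \<noteq> 0\<close> \<open>k \<le> 3\<close> by (rule polyfun_roots_finite)
  moreover have "{t. moment t \<in> L} \<subseteq> {t. (\<Sum>i\<le>3. c i * t ^ i) = 0}"
  proof safe
    fix t assume "moment t \<in> L"
    then have "g (moment t) $ 1 = 0"
      using gL by simp
    then show "(\<Sum>i\<le>3. c i * t ^ i) = 0"
      unfolding gx by (simp add: moment_def numeral_3_eq_3 mult.commute eval_nat_numeral)
  qed
  ultimately show ?thesis
    by (rule finite_subset[rotated])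
qed

lemma avoid_subspaces:
  fixes \<L> :: "(complex^4) set set"
  assumes "finite \<L>" "\<And>L. L \<in> \<L> \<Longrightarrow> vec.subspace L \<and> vec.dim L \<le> 3"
  obtains w where "w \<notin> \<Union>\<L>"
proof -
  have "finite {t. moment t \<in> L}" if "L \<in> \<L>" for L
  proof (rule finite_moment_in_subspace)
    show "vec.subspace L"
      using assms that by blast
    show "L \<noteq> UNIV"
      using assms(2)[OF that] vec_dim_card[where 'a = complex and 'n = 4] by auto
  qed
  then have "finite (\<Union>L\<in>\<L>. {t. moment t \<in> L})"
    using assms(1) by blast
  then obtain t where "t \<notin> (\<Union>L\<in>\<L>. {t. moment t \<in> L})"
    using ex_new_if_finite[OF infinite_UNIV_char_0] by blast
  then show thesis
    using that by blast
qed

text \<open>The vector w1 is chosen outside every L, and w2 outside every span of L and w1, of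
  dimension at most 3. The plane of w1 and w2 then meets each L only in 0.\<close>

lemma avoid_subspaces_plane:
  fixes \<L> :: "(complex^4) set set"
  assumes "finite \<L>" "\<And>L. L \<in> \<L> \<Longrightarrow> vec.subspace L \<and> vec.dim L \<le> 2"
  obtains w1 w2 where "\<And>r s. r \<noteq> 0 \<or> s \<noteq> 0 \<Longrightarrow> r *s w1 + s *s w2 \<notin> \<Union>\<L>"
proof -
  have "vec.subspace L \<and> vec.dim L \<le> 3" if "L \<in> \<L>" for L
    using assms(2)[OF that] by simp
  then obtain w1 where w1: "w1 \<notin> \<Union>\<L>"
    using avoid_subspaces[OF assms(1)] by blast
  let ?\<L> = "(\<lambda>L. vec.span (insert w1 L)) ` \<L>"
  have "vec.subspace L \<and> vec.dim L \<le> 3" if "L \<in> ?\<L>" for L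
  proof -
    obtain K where K: "K \<in> \<L>" "L = vec.span (insert w1 K)"
      using \<open>L \<in> ?\<L>\<close> by blast
    have "vec.dim L \<le> vec.dim K + 1"
      unfolding K(2) vec.dim_span vec.dim_insert by simp
    then show ?thesis
      using assms(2)[OF K(1)] by (auto simp: K(2))
  qed
  then obtain w2 where w2: "w2 \<notin> \<Union>?\<L>"
    using avoid_subspaces[of ?\<L>] assms(1) by blast
  show thesis
  proof (rule that[of w1 w2], rule notI)
    fix r s :: complex assume rs: "r \<noteq> 0 \<or> s \<noteq> 0" and "r *s w1 + s *s w2 \<in> \<Union>\<L>"
    then obtain L where L: "L \<in> \<L>" "r *s w1 + s *s w2 \<in> L" by blast
    have sub: "vec.subspace L"
      using assms(2) L(1) by blast
    show False
    proof (cases "s = 0")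
      case True
      then have "w1 \<in> L"
        using subspace_scale_cancel[OF sub, of r w1] L(2) rs by simp
      then show False
        using w1 L(1) by blast
    next
      case False
      let ?K = "vec.span (insert w1 L)"
      have "r *s w1 + s *s w2 \<in> ?K" "r *s w1 \<in> ?K"
        using L(2) by (auto intro: vec.span_base vec.span_scale)
      then have "(r *s w1 + s *s w2) - r *s w1 \<in> ?K"
        by (rule vec.span_diff)
      then have "w2 \<in> ?K"
        using subspace_scale_cancel[OF vec.subspace_span False] by (simp only: add_diff_cancel_left')
      then show False
        using w2 L(1) by blast
    qed
  qed
qed

text \<open>Divided differences at three parameters: differences of two points give c1 + (s + t) c2,
  and a difference of two of these gives c2.\<close>

lemma finite_curve_in_subspace:
  fixes L :: "('a::field^'n) set"
  assumes "vec.subspace L" "infinite {t. c0 + t *s c1 + t\<^sup>2 *s c2 \<in> L}"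
  shows "c0 \<in> L" "c1 \<in> L" "c2 \<in> L"
proof -
  let ?T = "{t. c0 + t *s c1 + t\<^sup>2 *s c2 \<in> L}"
  have inf: "infinite (?T - F)" if "finite F" for F
    using assms(2) that by simp
  obtain t1 where t1: "t1 \<in> ?T"
    using infinite_imp_nonempty[OF assms(2)] by auto
  obtain t2 where t2: "t2 \<in> ?T" "t2 \<noteq> t1"
    using infinite_imp_nonempty[OF inf[of "{t1}"]] by auto
  obtain t3 where t3: "t3 \<in> ?T" "t3 \<noteq> t1" "t3 \<noteq> t2"
    using infinite_imp_nonempty[OF inf[of "{t1, t2}"]] by auto
  have secant: "c1 + (s + t) *s c2 \<in> L" if "s \<in> ?T" "t \<in> ?T" "s \<noteq> t" for s t
  proof -
    have "(c0 + s *s c1 + s\<^sup>2 *s c2) - (c0 + t *s c1 + t\<^sup>2 *s c2) \<in> L"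
      using that assms(1) by (intro vec.subspace_diff) auto
    moreover have "(c0 + s *s c1 + s\<^sup>2 *s c2) - (c0 + t *s c1 + t\<^sup>2 *s c2) = (s - t) *s (c1 + (s + t) *s c2)"
      by (simp add: vec_eq_iff algebra_simps power2_eq_square)
    ultimately have *: "(s - t) *s (c1 + (s + t) *s c2) \<in> L"
      by (simp only:)
    have "s - t \<noteq> 0"
      using that(3) by simp
    then show ?thesis
      using * by (rule subspace_scale_cancel[OF assms(1)])
  qed
  have "(c1 + (t2 + t1) *s c2) - (c1 + (t3 + t1) *s c2) \<in> L"
    using t1 t2 t3 assms(1) by (intro vec.subspace_diff secant) auto
  moreover have "(c1 + (t2 + t1) *s c2) - (c1 + (t3 + t1) *s c2) = (t2 - t3) *s c2"
    by (simp add: vec_eq_iff algebra_simps)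
  ultimately have *: "(t2 - t3) *s c2 \<in> L"
    by (simp only:)
  have "t2 - t3 \<noteq> 0"
    using t3(3) by simp
  then show c2: "c2 \<in> L"
    using * by (rule subspace_scale_cancel[OF assms(1)])
  have "(c1 + (t2 + t1) *s c2) - (t2 + t1) *s c2 \<in> L"
    using t1 t2 c2 assms(1) by (intro vec.subspace_scale vec.subspace_diff secant) auto
  then show c1: "c1 \<in> L" by simp
  have "c0 + t1 *s c1 + t1\<^sup>2 *s c2 \<in> L"
    using t1 by simp
  moreover have "t1 *s c1 + t1\<^sup>2 *s c2 \<in> L"
    using c1 c2 assms(1) by (intro vec.subspace_scale vec.subspace_add)
  ultimately have "(c0 + t1 *s c1 + t1\<^sup>2 *s c2) - (t1 *s c1 + t1\<^sup>2 *s c2) \<in> L"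
    by (rule vec.subspace_diff[OF assms(1)])
  then show "c0 \<in> L" by simp
qed

lemma complex_quadratic_root:
  fixes a b c :: complex
  obtains r s where "r \<noteq> 0 \<or> s \<noteq> 0" "a * r\<^sup>2 + b * r * s + c * s\<^sup>2 = 0"
proof (cases "a = 0")
  case True
  then show thesis
    using that[of 1 0] by simp
next
  case False
  let ?r = "(- b + csqrt (b\<^sup>2 - 4 * a * c)) / (2 * a)"
  have "a * ?r\<^sup>2 + b * ?r + c = ((csqrt (b\<^sup>2 - 4 * a * c))\<^sup>2 - b\<^sup>2 + 4 * a * c) / (4 * a)"
    using False by (simp add: power_divide field_simps power2_eq_square)
  also have "\<dots> = 0"
    by simp
  finally show thesis
    using that[of ?r 1] by simp
qed

section \<open>Lines and conics through a point of a quadric\<close>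

locale bilinear_form =
  fixes \<beta> :: "complex^4 \<Rightarrow> complex^4 \<Rightarrow> complex"
  assumes add_left: "\<beta> (x + x') y = \<beta> x y + \<beta> x' y"
    and add_right: "\<beta> x (y + y') = \<beta> x y + \<beta> x y'"
    and scale_left: "\<beta> (c *s x) y = c * \<beta> x y"
    and scale_right: "\<beta> x (c *s y) = c * \<beta> x y"
begin

lemmas expand = add_left add_right scale_left scale_right

text \<open>Any irreducible component of the quadric through the given point is swept out by lines or
  conics through it, and only finitely many of their points can lie on the given lines.\<close>

lemma curve_through_point:
  assumes x: "\<beta> x x = 0"
    and \<L>: "finite \<L>" "\<And>L. L \<in> \<L> \<Longrightarrow> vec.subspace L \<and> vec.dim L \<le> 2"
  obtains c c1 c2 where "c \<noteq> 0"
    and "\<And>t. \<beta> (c *s x + t *s c1 + t\<^sup>2 *s c2) (c *s x + t *s c1 + t\<^sup>2 *s c2) = 0"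
    and "finite {t. c *s x + t *s c1 + t\<^sup>2 *s c2 \<in> \<Union>\<L>}"
proof -
  have fin: "finite {t. c0 + t *s c1 + t\<^sup>2 *s c2 \<in> \<Union>\<L>}"
    if avoid: "\<And>L. L \<in> \<L> \<Longrightarrow> \<not> (c0 \<in> L \<and> c1 \<in> L \<and> c2 \<in> L)" for c0 c1 c2
  proof -
    have "finite {t. c0 + t *s c1 + t\<^sup>2 *s c2 \<in> L}" if "L \<in> \<L>" for L
      using finite_curve_in_subspace[of L c0 c1 c2] \<L>(2)[OF that] avoid[OF that] by blast
    then have "finite (\<Union>L\<in>\<L>. {t. c0 + t *s c1 + t\<^sup>2 *s c2 \<in> L})"
      using \<L>(1) by blast
    then show ?thesis
      by (rule finite_subset[rotated]) blast
  qed
  \<comment> \<open>This is the derivative of y \<mapsto> \<beta> y y at x; its zero set is the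
    tangent space, or everything if x is singular.\<close>
  define b where "b y = \<beta> x y + \<beta> y x" for y
  \<comment> \<open>If x is a smooth point and the quadric does not contain its tangent plane there,
    a conic is used. Otherwise the line through x and a suitable z lies in the quadric.\<close>
  show thesis
  proof (cases "(\<exists>w. b w = 0 \<and> \<beta> w w \<noteq> 0) \<and> (\<exists>w. b w \<noteq> 0)")
    case True
    then obtain w1 w2 where w1: "b w1 = 0" "\<beta> w1 w1 \<noteq> 0" and w2: "b w2 \<noteq> 0"
      by blast
    have w1': "\<beta> w1 x = - \<beta> x w1"
      using w1 by (simp add: b_def eq_neg_iff_add_eq_0 add.commute)
    \<comment> \<open>The line through x in direction y meets the quadric again in b y *s y -
      \<beta> y y *s x. With y = w1 + t *s w2 and b w1 = 0 this is a polynomial of degree 2 in t; w1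
      is tangent, so the value at t = 0 is a multiple of x.\<close>
    define c1 where "c1 = b w2 *s w1 + (- (\<beta> w1 w2 + \<beta> w2 w1)) *s x"
    define c2 where "c2 = b w2 *s w2 + (- \<beta> w2 w2) *s x"
    show thesis
    proof (rule that[of "- \<beta> w1 w1" c1 c2])
      show "- \<beta> w1 w1 \<noteq> 0"
        using w1 by simp
      show "\<beta> ((- \<beta> w1 w1) *s x + t *s c1 + t\<^sup>2 *s c2) ((- \<beta> w1 w1) *s x + t *s c1 + t\<^sup>2 *s c2) = 0" for t
        unfolding c1_def c2_def expand x w1' by (simp add: b_def) algebra
      show "finite {t. (- \<beta> w1 w1) *s x + t *s c1 + t\<^sup>2 *s c2 \<in> \<Union>\<L>}"
      proof (rule fin, rule notI, elim conjE)
        fix L assume L: "L \<in> \<L>" and *: "(- \<beta> w1 w1) *s x \<in> L" "c1 \<in> L" "c2 \<in> L"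
        have sub: "vec.subspace L" and dim: "vec.dim L \<le> 2"
          using \<L>(2)[OF L] by auto
        have xL: "x \<in> L"
          using subspace_scale_cancel[OF sub _ *(1)] w1 by simp
        have "c1 - (- (\<beta> w1 w2 + \<beta> w2 w1)) *s x \<in> L"
          by (intro vec.subspace_scale vec.subspace_diff sub * xL)
        then have w1L: "w1 \<in> L"
          using subspace_scale_cancel[OF sub w2] by (simp add: c1_def)
        have "c2 - (- \<beta> w2 w2) *s x \<in> L"
          by (intro vec.subspace_scale vec.subspace_diff sub * xL)
        then have w2L: "w2 \<in> L"
          using subspace_scale_cancel[OF sub w2] by (simp add: c2_def)
        have x0: "x \<noteq> 0"
          using w2 scale_left[of 0 0] scale_right[of _ 0 0] by (auto simp: b_def)
        \<comment> \<open>x is isotropic but w1 is not, and b vanishes at x and w1 but not at w2.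
          Hence the three vectors are independent and do not fit into a subspace of dimension
          2.\<close>
        have 1: "w1 \<notin> vec.span {x}"
          using w1 x by (auto simp: span_single expand)
        have 2: "w2 \<notin> vec.span {w1, x}"
        proof
          assume "w2 \<in> vec.span {w1, x}"
          then obtain s r where "w2 = s *s w1 + r *s x"
            by (auto simp: vec.span_insert span_single algebra_simps)
          then have "b w2 = s * b w1"
            using x by (simp add: b_def expand algebra_simps)
          then show False
            using w1 w2 by simp
        qed
        have "vec.dim {w2, w1, x} = 3"
          using 1 2 x0 by (simp add: vec.dim_insert)
        moreover have "vec.dim {w2, w1, x} \<le> vec.dim L"
          using xL w1L w2L by (intro vec.dim_subset) auto
        ultimately show False
          using dim by simp
      qed
    qed
  next
    case False
    obtain w1 w2 where w: "\<And>r s. r \<noteq> 0 \<or> s \<noteq> 0 \<Longrightarrow> r *s w1 + s *s w2 \<notin> \<Union>\<L>"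
      using avoid_subspaces_plane[OF \<L>] by blast
    \<comment> \<open>In the plane of w1 and w2, a nonzero tangent vector is isotropic by the
      failure of the first case. If b is zero, an isotropic vector comes from a quadratic
      equation.\<close>
    have "\<exists>z. z \<notin> \<Union>\<L> \<and> b z = 0 \<and> \<beta> z z = 0"
    proof (cases "\<exists>w. b w \<noteq> 0")
      case True
      have "\<exists>r s. (r \<noteq> 0 \<or> s \<noteq> 0) \<and> b (r *s w1 + s *s w2) = 0"
      proof (cases "b w1 = 0")
        case True
        then show ?thesis
          by (intro exI[of _ 1] exI[of _ 0]) (simp add: b_def expand)
      next
        case False
        have comb: "b (b w2 *s w1 + (- b w1) *s w2) = 0"
          unfolding b_def expand by (simp add: algebra_simps)
        from False show ?thesis
          using comb by (metis neg_equal_0_iff_equal)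
      qed
      then show ?thesis
        using w False True by blast
    next
      case b0: False
      obtain r s where rs: "r \<noteq> 0 \<or> s \<noteq> 0"
          "\<beta> w1 w1 * r\<^sup>2 + (\<beta> w1 w2 + \<beta> w2 w1) * r * s + \<beta> w2 w2 * s\<^sup>2 = 0"
        using complex_quadratic_root by blast
      have "\<beta> (r *s w1 + s *s w2) (r *s w1 + s *s w2) = 0"
        unfolding expand using rs(2) by algebra
      then show ?thesis
        using w rs(1) b0 by blast
    qed
    then obtain z where z: "z \<notin> \<Union>\<L>" "b z = 0" "\<beta> z z = 0"
      by blast
    show thesis
    proof (rule that[of 1 z 0])
      show "\<beta> (1 *s x + t *s z + t\<^sup>2 *s 0) (1 *s x + t *s z + t\<^sup>2 *s 0) = 0" for t
        using z(2,3) x by (simp add: expand b_def add.commute flip: distrib_left)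
      show "finite {t. 1 *s x + t *s z + t\<^sup>2 *s 0 \<in> \<Union>\<L>}"
        using z(1) by (intro fin) blast
    qed simp
  qed
qed

end

section \<open>The blow-up in coordinates\<close>

abbreviation epipole1 :: "camera \<times> camera \<Rightarrow> 3 proj"
  where "epipole1 P \<equiv> picture (fst P) (center (snd P))"

abbreviation epipole2 :: "camera \<times> camera \<Rightarrow> 3 proj"
  where "epipole2 P \<equiv> picture (snd P) (center (fst P))"

lemma Rep_center:
  assumes "a \<noteq> 0" "\<And>x. cmat C *v x = 0 \<longleftrightarrow> (\<exists>c. x = c *s a)"
  shows "Rep_proj (center C) = vec.span {a}"
proof -
  have "{x. cmat C *v x = 0} = vec.span {a}"
    using assms(2) by (auto simp: span_single)
  then show ?thesis
    using assms(1) by (simp add: center_def Abs_proj_inverse dim_span_single)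
qed

lemma hvecs_picture:
  assumes "x \<in> hvecs X" "cmat C *v x \<noteq> 0"
  shows "cmat C *v x \<in> hvecs (picture C X)"
proof -
  have "(*v) (cmat C) ` Rep_proj X = vec.span {cmat C *v x}"
  proof -
    have "(*v) (cmat C) ` {c *s x |c. True} = {cmat C *v (c *s x) |c. True}"
      by blast
    then show ?thesis
      unfolding Rep_proj_span[OF assms(1)] span_single by (simp only: vector_scalar_commute)
  qed
  then show ?thesis
    using assms(2) by (simp add: picture_def hvecs_def Abs_proj_inverse dim_span_single vec.span_base)
qed

lemma bvecs_iff: "(x, u, v) \<in> bvecs (X, U, V) \<longleftrightarrow> x \<in> hvecs X \<and> u \<in> hvecs U \<and> v \<in> hvecs V"
  by (simp add: bvecs_def)

lemma bvecs_ex: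
  obtains x u v where "x \<in> hvecs X" "u \<in> hvecs U" "v \<in> hvecs V"
  using hvecs_nonempty by metis

lemma ball_comprehension2: "(\<forall>f\<in>{g i j |i j. True}. \<phi> f) \<longleftrightarrow> (\<forall>i j. \<phi> (g i j))"
  by blast

lemma blowup_minors:
  "z \<in> blowup P \<longleftrightarrow> (\<forall>x u v. (x, u, v) \<in> bvecs z \<longrightarrow>
    (\<forall>i j. minor i j (cmat (fst P) *v x) u = 0) \<and> (\<forall>i j. minor i j (cmat (snd P) *v x) v = 0))"
  unfolding blowup_def zero_locus_def blowup_eqs_def mem_Collect_eq ball_Un ball_comprehension2 minor_def
  by (simp add: Ball_def split_paired_All) blast

text \<open>One choice of coordinate vectors suffices. The scalars s and t may be 0, which happens
  exactly over the first and the second center.\<close>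

lemma blowup_iff:
  assumes "x \<in> hvecs X" "u \<in> hvecs U" "v \<in> hvecs V"
  shows "(X, U, V) \<in> blowup P \<longleftrightarrow> (\<exists>s. cmat (fst P) *v x = s *s u) \<and> (\<exists>t. cmat (snd P) *v x = t *s v)"
proof
  assume "(X, U, V) \<in> blowup P"
  then have "\<forall>i j. minor i j (cmat (fst P) *v x) u = 0" "\<forall>i j. minor i j (cmat (snd P) *v x) v = 0"
    using assms unfolding blowup_minors bvecs_iff by blast+
  then show "(\<exists>s. cmat (fst P) *v x = s *s u) \<and> (\<exists>t. cmat (snd P) *v x = t *s v)"
    using minors_zero_iff assms hvecs_nonzero by metis
next
  assume "(\<exists>s. cmat (fst P) *v x = s *s u) \<and> (\<exists>t. cmat (snd P) *v x = t *s v)"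
  then obtain s t where st: "cmat (fst P) *v x = s *s u" "cmat (snd P) *v x = t *s v"
    by blast
  show "(X, U, V) \<in> blowup P"
    unfolding blowup_minors bvecs_iff
  proof (intro allI impI)
    fix x' u' v' assume "x' \<in> hvecs X \<and> u' \<in> hvecs U \<and> v' \<in> hvecs V"
    then obtain c d e where "x' = c *s x" "u' = d *s u" "v' = e *s v"
      using assms hvecs_iff by metis
    then show "(\<forall>i j. minor i j (cmat (fst P) *v x') u' = 0) \<and> (\<forall>i j. minor i j (cmat (snd P) *v x') v' = 0)"
      by (simp add: vector_scalar_commute st minor_scale_left minor_scale_right minor_self)
  qed
qed

lemma blowup_fund_form:
  assumes "(X, U, V) \<in> blowup P" "u \<in> hvecs U" "v \<in> hvecs V"
  shows "fund_form P u v = 0"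
proof -
  obtain x where "x \<in> hvecs X"
    using hvecs_nonempty by blast
  then show ?thesis
    using blowup_iff[of x X u U v V P] assms hvecs_nonzero unfolding fund_form_eq_0_iff by blast
qed

lemma blowup_exists:
  assumes "fund_form P u v = 0" "u \<in> hvecs U" "v \<in> hvecs V"
  obtains X where "(X, U, V) \<in> blowup P"
proof -
  obtain x s t where *: "x \<noteq> 0 \<or> s \<noteq> 0 \<or> t \<noteq> 0" "cmat (fst P) *v x = s *s u" "cmat (snd P) *v x = t *s v"
    using assms(1) unfolding fund_form_eq_0_iff by blast
  have "x \<noteq> 0"
    using * assms(2,3)[THEN hvecs_nonzero] by auto
  then obtain X where "x \<in> hvecs X"
    using hvecs_ex by blast
  then show thesis
    using that blowup_iff * assms(2,3) by blast
qed

lemma quadric_iff: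
  assumes "x \<in> hvecs X"
  shows "X \<in> quadric P Q \<longleftrightarrow> quadric_form P Q x = 0"
proof -
  have "quadric_form P Q x = 0 \<Longrightarrow> x' \<in> hvecs X \<Longrightarrow> quadric_form P Q x' = 0" for x'
    using hvecs_iff[OF assms] by (auto simp: quadric_form_def vector_scalar_commute fund_form_bilinear)
  then show ?thesis
    using assms by (auto simp: quadric_def zero_locus_def)
qed

lemma fund_form_swap: "fund_form (snd P, fst P) v u = 0 \<longleftrightarrow> fund_form P u v = 0"
  unfolding fund_form_eq_0_iff by auto

text \<open>The equations are the minors against one fixed coordinate vector of U. They are
  homogeneous, so such loci can be united in the complement of the generic points.\<close>

lemma hclosed_cam1: "hclosed bvecs {z. cam1 z = U}"
proof -
  obtain u where u: "u \<in> hvecs U"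
    using hvecs_nonempty by blast
  define F where "F = {\<lambda>w :: bvec. minor i j (fst (snd w)) u |i j. True}"
  have "F \<subseteq> polyfun"
    by (auto simp: F_def intro!: polymap_intros)
  moreover have "zero_homogeneous bvecs f" if "f \<in> F" for f
  proof -
    obtain i j where f: "f = (\<lambda>w. minor i j (fst (snd w)) u)"
      using \<open>f \<in> F\<close> unfolding F_def by blast
    show ?thesis
      unfolding zero_homogeneous_def f
    proof (clarsimp simp: bvecs_iff)
      fix U' u1 u2 assume "minor i j u1 u = 0" "u1 \<in> hvecs U'" "u2 \<in> hvecs U'"
      then show "minor i j u2 u = 0"
        using hvecs_iff by (metis minor_scale_left mult_zero_right)
    qed
  qed
  moreover have "{z. cam1 z = U} = zero_locus bvecs F"
  proof (intro set_eqI, clarify)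
    fix X :: "4 proj" and U' V :: "3 proj"
    obtain x u' v where w: "x \<in> hvecs X" "u' \<in> hvecs U'" "v \<in> hvecs V"
      using bvecs_ex by blast
    have "(X, U', V) \<in> zero_locus bvecs F \<longleftrightarrow> (\<forall>i j. \<forall>w\<in>bvecs (X, U', V). minor i j (fst (snd w)) u = 0)"
      unfolding zero_locus_def F_def mem_Collect_eq ball_comprehension2 ..
    also have "\<dots> \<longleftrightarrow> (\<forall>u'\<in>hvecs U'. \<forall>i j. minor i j u' u = 0)"
      using w(1,3) by (auto simp: bvecs_def)
    also have "\<dots> \<longleftrightarrow> (\<forall>u'\<in>hvecs U'. U' = U)"
      using minors_zero_iff[OF hvecs_nonzero[OF u]] hvecs_proportional[OF _ u] by simp
    finally show "(X, U', V) \<in> {z. cam1 z = U} \<longleftrightarrow> (X, U', V) \<in> zero_locus bvecs F"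
      using w(2) by (auto simp: cam1_def)
  qed
  ultimately show ?thesis
    unfolding hclosed_def by blast
qed

lemma hclosed_cam2: "hclosed bvecs {z. cam2 z = V}"
proof -
  obtain v where v: "v \<in> hvecs V"
    using hvecs_nonempty by blast
  define F where "F = {\<lambda>w :: bvec. minor i j (snd (snd w)) v |i j. True}"
  have "F \<subseteq> polyfun"
    by (auto simp: F_def intro!: polymap_intros)
  moreover have "zero_homogeneous bvecs f" if "f \<in> F" for f
  proof -
    obtain i j where f: "f = (\<lambda>w. minor i j (snd (snd w)) v)"
      using \<open>f \<in> F\<close> unfolding F_def by blast
    show ?thesis
      unfolding zero_homogeneous_def f
    proof (clarsimp simp: bvecs_iff)
      fix V' v1 v2 assume "minor i j v1 v = 0" "v1 \<in> hvecs V'" "v2 \<in> hvecs V'"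
      then show "minor i j v2 v = 0"
        using hvecs_iff by (metis minor_scale_left mult_zero_right)
    qed
  qed
  moreover have "{z. cam2 z = V} = zero_locus bvecs F"
  proof (intro set_eqI, clarify)
    fix X :: "4 proj" and U V' :: "3 proj"
    obtain x u v' where w: "x \<in> hvecs X" "u \<in> hvecs U" "v' \<in> hvecs V'"
      using bvecs_ex by blast
    have "(X, U, V') \<in> zero_locus bvecs F \<longleftrightarrow> (\<forall>i j. \<forall>w\<in>bvecs (X, U, V'). minor i j (snd (snd w)) v = 0)"
      unfolding zero_locus_def F_def mem_Collect_eq ball_comprehension2 ..
    also have "\<dots> \<longleftrightarrow> (\<forall>v'\<in>hvecs V'. \<forall>i j. minor i j v' v = 0)"
      using w(1,2) by (auto simp: bvecs_def)
    also have "\<dots> \<longleftrightarrow> (\<forall>v'\<in>hvecs V'. V' = V)"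
      using minors_zero_iff[OF hvecs_nonzero[OF v]] hvecs_proportional[OF _ v] by simp
    finally show "(X, U, V') \<in> {z. cam2 z = V} \<longleftrightarrow> (X, U, V') \<in> zero_locus bvecs F"
      using w(3) by (auto simp: cam2_def)
  qed
  ultimately show ?thesis
    unfolding hclosed_def by blast
qed

locale camera_setup =
  fixes P :: "camera \<times> camera" and a b :: "complex^4" and R S :: "complex^3^4"
  assumes pair: "camera_pair (cmat (fst P)) (cmat (snd P)) a b R S"
    and a_center: "a \<in> hvecs (center (fst P))"
    and b_center: "b \<in> hvecs (center (snd P))"

sublocale camera_setup \<subseteq> camera_pair "cmat (fst P)" "cmat (snd P)" a b R S
  by (rule pair)

lemma camera_setup_exists:
  assumes "is_camera (fst P)" "is_camera (snd P)" "center (fst P) \<noteq> center (snd P)"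
  obtains a b R S where "camera_setup P a b R S"
proof -
  obtain a where a: "a \<noteq> 0" "\<And>x. cmat (fst P) *v x = 0 \<longleftrightarrow> (\<exists>c. x = c *s a)"
    using camera_kernel[OF assms(1)] by metis
  obtain b where b: "b \<noteq> 0" "\<And>x. cmat (snd P) *v x = 0 \<longleftrightarrow> (\<exists>c. x = c *s b)"
    using camera_kernel[OF assms(2)] by metis
  obtain R where R: "cmat (fst P) ** R = mat 1"
    using camera_right_inverse[OF assms(1)] by metis
  obtain S where S: "cmat (snd P) ** S = mat 1"
    using camera_right_inverse[OF assms(2)] by metis
  have centers: "a \<in> hvecs (center (fst P))" "b \<in> hvecs (center (snd P))"
    using a(1) b(1) by (auto simp: hvecs_def Rep_center[OF a] Rep_center[OF b] vec.span_base)
  then have "b \<noteq> c *s a" for c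
    using hvecs_proportional[OF centers(2,1)] assms(3) by metis
  then have "camera_setup P a b R S"
    using centers a b R S by (simp add: camera_setup_def camera_pair_def)
  then show thesis
    by (rule that)
qed

section \<open>Epipoles, kernels of the form and local triangulation on the blow-up\<close>

context camera_setup
begin

lemma swap_setup: "camera_setup (snd P, fst P) b a S R"
  using swap a_center b_center by (simp add: camera_setup_def)

lemma epipole1: "cmat (fst P) *v b \<in> hvecs (epipole1 P)"
  using b_center A_b_nonzero by (rule hvecs_picture)

lemma epipole2: "cmat (snd P) *v a \<in> hvecs (epipole2 P)"
  using a_center B_a_nonzero by (rule hvecs_picture)

lemma eq_epipole1: "u \<in> hvecs U \<Longrightarrow> U = epipole1 P \<longleftrightarrow> (\<exists>c. u = c *s (cmat (fst P) *v b))"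
  using hvecs_proportional[OF _ epipole1] .

lemma eq_epipole2: "v \<in> hvecs V \<Longrightarrow> V = epipole2 P \<longleftrightarrow> (\<exists>c. v = c *s (cmat (snd P) *v a))"
  using hvecs_proportional[OF _ epipole2] .

lemma eq_center1: "x \<in> hvecs X \<Longrightarrow> X = center (fst P) \<longleftrightarrow> cmat (fst P) *v x = 0"
  using hvecs_proportional[OF _ a_center] ker_A by simp

lemma eq_center2: "x \<in> hvecs X \<Longrightarrow> X = center (snd P) \<longleftrightarrow> cmat (snd P) *v x = 0"
  using hvecs_proportional[OF _ b_center] ker_B by simp

lemma fund_form_epipole1: "fund_form P (cmat (fst P) *v b) v = 0"
  unfolding fund_form_eq_0_iff
  by (intro exI[of _ b] exI[of _ 1] exI[of _ 0]) (simp add: B_b)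

lemma fund_form_epipole2: "fund_form P u (cmat (snd P) *v a) = 0"
  unfolding fund_form_eq_0_iff
  by (intro exI[of _ a] exI[of _ 0] exI[of _ 1]) (simp add: A_a)

text \<open>The second image of the ray of u lies on the line spanned by B R u and B a, its epipolar
  line. For a v off this line the rays of u and v do not meet, unless u is the epipole, whose ray
  passes through the second center.\<close>

lemma fund_form_left_kernel:
  assumes "\<And>v. fund_form P u v = 0"
  shows "\<exists>c. u = c *s (cmat (fst P) *v b)"
proof (rule ccontr)
  assume no: "\<nexists>c. u = c *s (cmat (fst P) *v b)"
  then have u: "u \<noteq> 0"
    by (metis vec.scale_zero_left)
  let ?W = "vec.span {cmat (snd P) *v (R *v u), cmat (snd P) *v a}"
  have "vec.dim ?W \<le> card {cmat (snd P) *v (R *v u), cmat (snd P) *v a}"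
    by (rule vec.dim_le_card) auto
  also have "\<dots> \<le> 2"
    by (simp add: card_insert_if)
  finally have dim: "vec.dim ?W \<le> 2" .
  have dim_UNIV: "vec.dim (UNIV :: (complex^3) set) = 3"
    unfolding vec_dim_card by simp
  have "?W \<noteq> UNIV"
  proof
    assume "?W = UNIV"
    then have "vec.dim ?W = 3"
      using dim_UNIV by (simp only:)
    then show False
      using dim by linarith
  qed
  then obtain v where v: "v \<notin> ?W" by blast
  obtain x s t where *: "x \<noteq> 0 \<or> s \<noteq> 0 \<or> t \<noteq> 0" "cmat (fst P) *v x = s *s u" "cmat (snd P) *v x = t *s v"
    using assms[of v] unfolding fund_form_eq_0_iff by blast
  have x: "x \<noteq> 0"
  proof
    assume "x = 0"
    moreover have "v \<noteq> 0"
      using v vec.span_zero by blast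
    ultimately show False
      using * u by auto
  qed
  obtain r where r: "x = s *s (R *v u) + r *s a"
    using preimage_line[OF *(2)] .
  have "t *s v = s *s (cmat (snd P) *v (R *v u)) + r *s (cmat (snd P) *v a)"
    using *(3) by (simp add: r matrix_vector_right_distrib vector_scalar_commute)
  also have "\<dots> \<in> ?W"
    by (intro vec.span_add vec.span_scale vec.span_base) auto
  finally have tv: "t *s v \<in> ?W" .
  have "t \<noteq> 0"
    using scale_nonzero[OF x *(2,3)] no by blast
  then show False
    using subspace_scale_cancel[OF vec.subspace_span _ tv] v by blast
qed

lemma fund_form_right_kernel:
  assumes "\<And>u. fund_form P u v = 0"
  shows "\<exists>c. v = c *s (cmat (snd P) *v a)"
  using camera_setup.fund_form_left_kernel[OF swap_setup, of v] assms fund_form_swap by simp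

lemma blowup_unique:
  assumes "(X, U, V) \<in> blowup P" "(X', U, V) \<in> blowup P" "\<not> (U = epipole1 P \<and> V = epipole2 P)"
  shows "X = X'"
proof -
  obtain x u v where w: "x \<in> hvecs X" "u \<in> hvecs U" "v \<in> hvecs V"
    using bvecs_ex by blast
  obtain x' where x': "x' \<in> hvecs X'"
    using hvecs_nonempty by blast
  obtain s t where st: "cmat (fst P) *v x = s *s u" "cmat (snd P) *v x = t *s v"
    using assms(1) blowup_iff[OF w] by blast
  obtain s' t' where st': "cmat (fst P) *v x' = s' *s u" "cmat (snd P) *v x' = t' *s v"
    using assms(2) blowup_iff[OF x' w(2,3)] by blast
  have "\<not> ((\<exists>c. u = c *s (cmat (fst P) *v b)) \<and> (\<exists>c. v = c *s (cmat (snd P) *v a)))"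
    using assms(3) eq_epipole1[OF w(2)] eq_epipole2[OF w(3)] by blast
  then have "\<exists>c. x' = c *s x"
    using unique[OF hvecs_nonzero[OF w(1)] st hvecs_nonzero[OF x'] st'] by blast
  then show ?thesis
    using hvecs_proportional[OF x' w(1)] by simp
qed

text \<open>The polynomial d is a Cramer denominator that is nonzero over U. Both d and T read only
  the two image coordinates, so w may be a coordinate vector of a point X of the other blow-up; this
  is how conjugates are computed.\<close>

lemma local_triangulation1:
  assumes "U \<noteq> epipole1 P"
  obtains d :: "bvec \<Rightarrow> complex" and T :: "bvec \<Rightarrow> complex^4"
  where "d \<in> polyfun" "polymap T" "zero_homogeneous bvecs d"
    and "\<And>w X V. w \<in> bvecs (X, U, V) \<Longrightarrow> d w \<noteq> 0"
    and "\<And>Y U V X w. (Y, U, V) \<in> blowup P \<Longrightarrow> w \<in> bvecs (X, U, V) \<Longrightarrow> d w \<noteq> 0 \<Longrightarrow> T w \<in> hvecs Y"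
proof -
  obtain u0 where u0: "u0 \<in> hvecs U"
    using hvecs_nonempty by blast
  then have "u0 \<noteq> c *s (cmat (fst P) *v b)" for c
    using eq_epipole1 assms by blast
  then obtain i j where ij: "minor i j (cmat (snd P) *v (R *v u0)) (cmat (snd P) *v a) \<noteq> 0"
    using minor_nonzero by metis
  define d where "d w = minor i j (cmat (snd P) *v (R *v fst (snd w))) (cmat (snd P) *v a)" for w :: bvec
  define T where "T w = triangulate i j (fst (snd w)) (snd (snd w))" for w :: bvec
  have d_scale: "d (x', c *s u, v') = c * d (x, u, v)" for x x' c u v v'
    by (simp add: d_def vector_scalar_commute minor_scale_left)
  show thesis
  proof (rule that[of d T])
    show "d \<in> polyfun"
      unfolding d_def by (intro polymap_intros)
    show "polymap T"
      unfolding T_def triangulate_def by (intro polymap_intros)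
    show "zero_homogeneous bvecs d"
      unfolding zero_homogeneous_def
    proof (clarsimp simp: bvecs_iff)
      fix U x u v x' u' v' assume "d (x, u, v) = 0" "u \<in> hvecs U" "u' \<in> hvecs U"
      moreover from this obtain c where "u' = c *s u"
        using hvecs_iff by blast
      ultimately show "d (x', u', v') = 0"
        using d_scale[of x' c u v' x v] by simp
    qed
    show "d w \<noteq> 0" if w: "w \<in> bvecs (X, U, V)" for w X V
    proof -
      obtain x u v where w': "w = (x, u, v)" "u \<in> hvecs U"
        using w by (cases w) (auto simp: bvecs_iff)
      then obtain c where "c \<noteq> 0" "u = c *s u0"
        using hvecs_iff[OF u0] by blast
      then show ?thesis
        using ij d_scale[of x c u0 v x v] by (simp add: w'(1)) (simp add: d_def)
    qed
    show "T w \<in> hvecs Y" if Y: "(Y, U, V) \<in> blowup P" and w: "w \<in> bvecs (X, U, V)" and d: "d w \<noteq> 0"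
      for Y U V X w
    proof -
      obtain x u v where w': "w = (x, u, v)" "u \<in> hvecs U" "v \<in> hvecs V"
        using w by (cases w) (auto simp: bvecs_iff)
      obtain y where y: "y \<in> hvecs Y"
        using hvecs_nonempty by blast
      obtain s t where st: "cmat (fst P) *v y = s *s u" "cmat (snd P) *v y = t *s v"
        using Y blowup_iff[OF y w'(2,3)] by blast
      obtain c where "c \<noteq> 0" "T w = c *s y"
        using triangulate_proportional[OF hvecs_nonzero[OF y] st, of i j] d by (auto simp: d_def T_def w')
      then show ?thesis
        using hvecs_scale[OF y] by simp
    qed
  qed
qed

lemma blowup_swap: "(X, V, U) \<in> blowup (snd P, fst P) \<longleftrightarrow> (X, U, V) \<in> blowup P"
proof -
  obtain x u v where w: "x \<in> hvecs X" "u \<in> hvecs U" "v \<in> hvecs V"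
    using bvecs_ex by blast
  show ?thesis
    unfolding blowup_iff[OF w] blowup_iff[OF w(1,3,2)] by auto
qed

lemma local_triangulation2:
  assumes "V \<noteq> epipole2 P"
  obtains d :: "bvec \<Rightarrow> complex" and T :: "bvec \<Rightarrow> complex^4"
  where "d \<in> polyfun" "polymap T" "zero_homogeneous bvecs d"
    and "\<And>w X U. w \<in> bvecs (X, U, V) \<Longrightarrow> d w \<noteq> 0"
    and "\<And>Y U V X w. (Y, U, V) \<in> blowup P \<Longrightarrow> w \<in> bvecs (X, U, V) \<Longrightarrow> d w \<noteq> 0 \<Longrightarrow> T w \<in> hvecs Y"
proof -
  have "V \<noteq> epipole1 (snd P, fst P)"
    using assms by simp
  then obtain d :: "bvec \<Rightarrow> complex" and T :: "bvec \<Rightarrow> complex^4" where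
    d: "d \<in> polyfun" "polymap T" "zero_homogeneous bvecs d"
      "\<And>w X U. w \<in> bvecs (X, V, U) \<Longrightarrow> d w \<noteq> 0"
      "\<And>Y U V X w. (Y, U, V) \<in> blowup (snd P, fst P) \<Longrightarrow> w \<in> bvecs (X, U, V) \<Longrightarrow> d w \<noteq> 0 \<Longrightarrow> T w \<in> hvecs Y"
    by (rule camera_setup.local_triangulation1[OF swap_setup]) blast
  \<comment> \<open>Exchanging the two images reduces to the first case for the swapped
    cameras.\<close>
  define \<sigma> :: "bvec \<Rightarrow> bvec" where "\<sigma> w = (fst w, snd (snd w), fst (snd w))" for w
  have \<sigma>: "polymap \<sigma>" "w \<in> bvecs (X, U, V) \<Longrightarrow> \<sigma> w \<in> bvecs (X, V, U)" for w X U V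
    unfolding \<sigma>_def by (intro polymap_intros) (auto simp: bvecs_def)
  show thesis
  proof (rule that[of "\<lambda>w. d (\<sigma> w)" "\<lambda>w. T (\<sigma> w)"])
    show "(\<lambda>w. d (\<sigma> w)) \<in> polyfun"
      using d(1) \<sigma>(1) by (rule polyfun_compose)
    show "polymap (\<lambda>w. T (\<sigma> w))"
      using d(2) \<sigma>(1) by (rule polymap_compose)
    show "zero_homogeneous bvecs (\<lambda>w. d (\<sigma> w))"
      using d(3) \<sigma>(2) unfolding zero_homogeneous_def by (metis prod_cases3)
    show "d (\<sigma> w) \<noteq> 0" if "w \<in> bvecs (X, U, V)" for w X U
      using d(4) \<sigma>(2) that by blast
    show "T (\<sigma> w) \<in> hvecs Y"
      if "(Y, U, V) \<in> blowup P" "w \<in> bvecs (X, U, V)" "d (\<sigma> w) \<noteq> 0" for Y U V X w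
      using d(5) \<sigma>(2) that blowup_swap by blast
  qed
qed

lemma local_triangulation:
  assumes "\<not> (U = epipole1 P \<and> V = epipole2 P)"
  obtains d :: "bvec \<Rightarrow> complex" and T :: "bvec \<Rightarrow> complex^4"
  where "d \<in> polyfun" "polymap T" "zero_homogeneous bvecs d"
    and "\<And>w X. w \<in> bvecs (X, U, V) \<Longrightarrow> d w \<noteq> 0"
    and "\<And>Y U V X w. (Y, U, V) \<in> blowup P \<Longrightarrow> w \<in> bvecs (X, U, V) \<Longrightarrow> d w \<noteq> 0 \<Longrightarrow> T w \<in> hvecs Y"
proof (cases "U = epipole1 P")
  case True
  then have "V \<noteq> epipole2 P"
    using assms by blast
  then show thesis
    by (rule local_triangulation2) (rule that)
next
  case False
  then show thesis
    by (rule local_triangulation1) (rule that)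
qed

end

section \<open>Conjugate points\<close>

text \<open>The set where g is nonzero is open, and closed because it is finite; the complex plane
  is connected and infinite.\<close>

lemma zero_by_continuity:
  fixes g :: "complex \<Rightarrow> complex"
  assumes "continuous_on UNIV g" "finite {t. g t \<noteq> 0}"
  shows "g t = 0"
proof -
  define N where "N = {t. g t \<noteq> 0}"
  have "open N"
    unfolding N_def using assms(1) by (intro open_Collect_neq) auto
  moreover have "closed N"
    unfolding N_def using assms(2) by (rule finite_imp_closed)
  ultimately have "N = {} \<or> N = UNIV"
    using clopen[of N] by simp
  moreover have "N \<noteq> UNIV"
    using assms(2) infinite_UNIV_char_0[where 'a = complex] by (metis N_def)
  ultimately show ?thesis
    by (auto simp: N_def)
qed

lemma continuous_on_smult:
  fixes f :: "'a::topological_space \<Rightarrow> complex" and g :: "'a \<Rightarrow> complex^'n"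
  assumes "continuous_on A f" "continuous_on A g"
  shows "continuous_on A (\<lambda>t. f t *s g t)"
  unfolding vector_scalar_mult_def by (intro continuous_intros assms)

text \<open>The vectors imaged into the span of e are spanned by R e and a: a line of projective
  space through the center.\<close>

lemma plane_subspace:
  fixes A :: "complex^4^3"
  assumes "\<And>x. A *v x = 0 \<longleftrightarrow> (\<exists>c. x = c *s a)" "A ** R = mat 1"
  shows "vec.subspace {x. \<exists>c. A *v x = c *s e} \<and> vec.dim {x. \<exists>c. A *v x = c *s e} \<le> 2"
proof
  have "{x. \<exists>c. A *v x = c *s e} \<subseteq> vec.span {R *v e, a}"
  proof clarify
    fix x c assume "A *v x = c *s e"
    then have "A *v (x - c *s (R *v e)) = 0"
      by (simp add: matrix_vector_mult_diff_distrib vector_scalar_commute matrix_vector_mul_assoc assms(2))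
    then obtain d where "x - c *s (R *v e) = d *s a"
      using assms(1) by blast
    then have x: "x = c *s (R *v e) + d *s a"
      by (simp add: algebra_simps)
    show "x \<in> vec.span {R *v e, a}"
      unfolding x by (intro vec.span_add vec.span_scale vec.span_base) auto
  qed
  then have "vec.dim {x. \<exists>c. A *v x = c *s e} \<le> card {R *v e, a}"
    by (rule vec.dim_le_card) simp
  also have "\<dots> \<le> 2"
    by (simp add: card_insert_if)
  finally show "vec.dim {x. \<exists>c. A *v x = c *s e} \<le> 2" .
  show "vec.subspace {x. \<exists>c. A *v x = c *s e}"
    unfolding vec.subspace_def
  proof (intro conjI ballI allI)
    show "0 \<in> {x. \<exists>c. A *v x = c *s e}"
      by (auto intro!: exI[of _ 0])
  next
    fix x y assume "x \<in> {x. \<exists>c. A *v x = c *s e}" "y \<in> {x. \<exists>c. A *v x = c *s e}"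
    then obtain c d where "A *v x = c *s e" "A *v y = d *s e" by blast
    then have "A *v (x + y) = (c + d) *s e"
      by (simp add: matrix_vector_right_distrib vec.scale_left_distrib)
    then show "x + y \<in> {x. \<exists>c. A *v x = c *s e}" by blast
  next
    fix k x assume "x \<in> {x. \<exists>c. A *v x = c *s e}"
    then obtain c where "A *v x = c *s e" by blast
    then have "A *v (k *s x) = (k * c) *s e"
      by (simp add: vector_scalar_commute vector_smult_assoc)
    then show "k *s x \<in> {x. \<exists>c. A *v x = c *s e}" by blast
  qed
qed

section \<open>Density of the generic points in the strict transform\<close>

definition off_centers :: "camera \<times> camera \<Rightarrow> camera \<times> camera \<Rightarrow> bpoint set"
  where "off_centers P Q =
    {z \<in> blowup P. blowdown z \<in> quadric P Q - {center (fst P), center (snd P)}}"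

lemma strict_transform_eq: "strict_transform P Q = blowup P \<inter> zclosure bvecs (off_centers P Q)"
  by (simp add: strict_transform_def off_centers_def)

lemma off_centers_subset: "off_centers P Q \<subseteq> strict_transform P Q"
  using zclosure_superset[of "off_centers P Q" bvecs] by (auto simp: strict_transform_eq off_centers_def)

text \<open>Removing the epipoles of P keeps points away from its centers; removing those of Q makes
  triangulation work and keeps conjugates away from the centers of Q.\<close>

definition generic :: "camera \<times> camera \<Rightarrow> camera \<times> camera \<Rightarrow> bpoint set"
  where "generic P Q = strict_transform P Q -
    ({z. cam1 z = epipole1 P} \<union> {z. cam1 z = epipole1 Q} \<union>
     {z. cam2 z = epipole2 P} \<union> {z. cam2 z = epipole2 Q})"

locale two_pairs = P: camera_setup P a b R S + Q: camera_setup Q a' b' R' S'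
  for P a b R S Q a' b' R' S'
begin

lemma exchange: "two_pairs Q a' b' R' S' P a b R S"
  by (intro two_pairs.intro P.camera_setup_axioms Q.camera_setup_axioms)

text \<open>Away from the centers s and t are nonzero, and the quadric form at x is s t times the
  fundamental form of Q at (u, v).\<close>

lemma off_centers_iff:
  assumes "(X, U, V) \<in> blowup P" "X \<noteq> center (fst P)" "X \<noteq> center (snd P)"
    and "u \<in> hvecs U" "v \<in> hvecs V"
  shows "(X, U, V) \<in> off_centers P Q \<longleftrightarrow> fund_form Q u v = 0"
proof -
  obtain x where x: "x \<in> hvecs X"
    using hvecs_nonempty by blast
  obtain s t where st: "cmat (fst P) *v x = s *s u" "cmat (snd P) *v x = t *s v"
    using assms(1) blowup_iff[OF x assms(4,5)] by blast
  have "s \<noteq> 0" "t \<noteq> 0"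
    using st P.eq_center1[OF x] P.eq_center2[OF x] assms(2,3) by auto
  then show ?thesis
    using assms(1-3) by (simp add: off_centers_def blowdown_def quadric_iff[OF x] quadric_form_def st
        fund_form_bilinear)
qed

text \<open>The equation involves only the image coordinates and is polynomial in them, so it passes
  to the closure, including the points over the centers.\<close>

lemma strict_transform_fund_form:
  assumes "(X, U, V) \<in> strict_transform P Q" "u \<in> hvecs U" "v \<in> hvecs V"
  shows "fund_form Q u v = 0"
proof -
  have poly: "(\<lambda>w :: bvec. fund_form Q (fst (snd w)) (snd (snd w))) \<in> polyfun"
    by (intro polyfun_fund_form polymap_intros)
  have "fund_form Q (fst (snd w)) (snd (snd w)) = 0"
    if z: "z \<in> off_centers P Q" and w: "w \<in> bvecs z" for z w
  proof -
    obtain X U V where z': "z = (X, U, V)" by (cases z)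
    have "(X, U, V) \<in> blowup P" "X \<noteq> center (fst P)" "X \<noteq> center (snd P)"
      using z by (auto simp: off_centers_def blowdown_def z')
    then show ?thesis
      using off_centers_iff w z by (cases w) (auto simp: z' bvecs_iff)
  qed
  moreover obtain x where "x \<in> hvecs X"
    using hvecs_nonempty by blast
  then have "(x, u, v) \<in> bvecs (X, U, V)"
    using assms by (simp add: bvecs_iff)
  moreover have "(X, U, V) \<in> zclosure bvecs (off_centers P Q)"
    using assms(1) by (simp add: strict_transform_eq)
  ultimately show ?thesis
    using poly unfolding in_zclosure_iff by fastforce
qed

lemma generic_off_centers:
  assumes "(X, U, V) \<in> blowup P" "u \<in> hvecs U" "v \<in> hvecs V" "fund_form Q u v = 0"
    and "U \<noteq> epipole1 P" "U \<noteq> epipole1 Q" "V \<noteq> epipole2 P" "V \<noteq> epipole2 Q"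
  shows "(X, U, V) \<in> off_centers P Q"
proof -
  obtain x where x: "x \<in> hvecs X"
    using hvecs_nonempty by blast
  obtain s t where st: "cmat (fst P) *v x = s *s u" "cmat (snd P) *v x = t *s v"
    using assms(1) blowup_iff[OF x assms(2,3)] by blast
  have "t \<noteq> 0"
    using P.scale_nonzero[OF hvecs_nonzero[OF x] st] P.eq_epipole1[OF assms(2)] assms(5) by blast
  moreover have "s \<noteq> 0"
    using camera_pair.scale_nonzero[OF P.swap hvecs_nonzero[OF x] st(2,1)] P.eq_epipole2[OF assms(3)] assms(7)
    by blast
  ultimately have "X \<noteq> center (fst P)" "X \<noteq> center (snd P)"
    using P.eq_center1[OF x] P.eq_center2[OF x] st assms(2,3) hvecs_nonzero by auto
  then show ?thesis
    using off_centers_iff assms by blast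
qed

text \<open>The curve supplied by \<open>curve_through_point\<close> has all but finitely many of
  its points in the generic set, so f vanishes on it outside finitely many parameters.\<close>

lemma off_centers_subset_generic: "off_centers P Q \<subseteq> zclosure bvecs (generic P Q)"
proof
  fix z assume z: "z \<in> off_centers P Q"
  obtain X U V where z': "z = (X, U, V)" by (cases z)
  show "z \<in> zclosure bvecs (generic P Q)"
    unfolding in_zclosure_iff
  proof (intro ballI impI)
    fix f :: "bvec \<Rightarrow> complex" and w
    assume f: "f \<in> polyfun" "\<forall>q\<in>generic P Q. \<forall>v\<in>bvecs q. f v = 0" and w: "w \<in> bvecs z"
    obtain x u v where w': "w = (x, u, v)" by (cases w)
    have x: "x \<in> hvecs X" and u: "u \<in> hvecs U" and v: "v \<in> hvecs V"
      using w by (auto simp: w' z' bvecs_iff)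
    have blow: "(X, U, V) \<in> blowup P" "X \<noteq> center (fst P)" "X \<noteq> center (snd P)"
      using z by (auto simp: off_centers_def blowdown_def z')
    obtain s t where st: "cmat (fst P) *v x = s *s u" "cmat (snd P) *v x = t *s v"
      using blow(1) blowup_iff[OF x u v] by blast
    have s: "s \<noteq> 0" and t: "t \<noteq> 0"
      using st P.eq_center1[OF x] P.eq_center2[OF x] blow by auto
    define \<beta> where "\<beta> x y = fund_form Q (cmat (fst P) *v x) (cmat (snd P) *v y)" for x y
    interpret \<beta>: bilinear_form \<beta>
      by unfold_locales
        (simp_all add: \<beta>_def matrix_vector_right_distrib vector_scalar_commute fund_form_bilinear)
    have "\<beta> x x = 0"
      using off_centers_iff[OF blow u v] z by (simp add: \<beta>_def st fund_form_bilinear z')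
    define plane1 where "plane1 e = {x. \<exists>c. cmat (fst P) *v x = c *s e}" for e
    define plane2 where "plane2 e = {x. \<exists>c. cmat (snd P) *v x = c *s e}" for e
    let ?\<L> = "{plane1 (cmat (fst P) *v b), plane1 (cmat (fst Q) *v b'),
      plane2 (cmat (snd P) *v a), plane2 (cmat (snd Q) *v a')}"
    have "vec.subspace L \<and> vec.dim L \<le> 2" if "L \<in> ?\<L>" for L
      using that plane_subspace[OF P.ker_A P.right_inverse_A] plane_subspace[OF P.ker_B P.right_inverse_B]
      unfolding plane1_def plane2_def by auto
    then obtain c c1 c2 where c: "c \<noteq> 0"
      "\<And>r. \<beta> (c *s x + r *s c1 + r\<^sup>2 *s c2) (c *s x + r *s c1 + r\<^sup>2 *s c2) = 0"
      "finite {r. c *s x + r *s c1 + r\<^sup>2 *s c2 \<in> \<Union>?\<L>}"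
      using \<beta>.curve_through_point[OF \<open>\<beta> x x = 0\<close>, of ?\<L>] by blast
    define \<gamma> where "\<gamma> r = c *s x + r *s c1 + r\<^sup>2 *s c2" for r
    have \<gamma>: "continuous_on UNIV \<gamma>"
      unfolding \<gamma>_def by (intro continuous_intros continuous_on_smult)
    \<comment> \<open>The factors normalize the lifted curve so that its value at 0 is w itself, not
      merely another coordinate vector of the same point.\<close>
    define \<Gamma> where "\<Gamma> r = ((1 / c) *s \<gamma> r, (1 / (c * s)) *s (cmat (fst P) *v \<gamma> r),
      (1 / (c * t)) *s (cmat (snd P) *v \<gamma> r))" for r
    have \<Gamma>_0: "\<Gamma> 0 = w"
      using c(1) s t by (simp add: \<Gamma>_def \<gamma>_def w' vector_scalar_commute st vector_smult_assoc)
    have "continuous_on UNIV \<Gamma>"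
      unfolding \<Gamma>_def
      by (intro continuous_on_Pair continuous_on_smult continuous_on_const \<gamma>
          bounded_linear.continuous_on[OF matrix_vector_mul_bounded_linear])
    then have cont: "continuous_on UNIV (\<lambda>r. f (\<Gamma> r))"
      by (rule continuous_on_compose2[OF continuous_on_polyfun_bvec[OF f(1)]]) simp
    have "f (\<Gamma> r) = 0" if r: "\<gamma> r \<notin> \<Union>?\<L>" for r
    proof -
      let ?y = "\<gamma> r"
      have not1: "cmat (fst P) *v ?y \<noteq> k *s (cmat (fst P) *v b)"
        "cmat (fst P) *v ?y \<noteq> k *s (cmat (fst Q) *v b')"
        and not2: "cmat (snd P) *v ?y \<noteq> k *s (cmat (snd P) *v a)"
        "cmat (snd P) *v ?y \<noteq> k *s (cmat (snd Q) *v a')" for k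
        \<comment> \<open>Off the four subspaces neither image of the curve point is an epipole of P
          or Q; the multiple 0 shows that both images are nonzero.\<close>
        using r unfolding plane1_def plane2_def by blast+
      from not1(1)[of 0] not2(1)[of 0]
      have nz: "cmat (fst P) *v ?y \<noteq> 0" "cmat (snd P) *v ?y \<noteq> 0" "?y \<noteq> 0"
        by auto
      then obtain Y U' V' where Y: "?y \<in> hvecs Y" "cmat (fst P) *v ?y \<in> hvecs U'" "cmat (snd P) *v ?y \<in> hvecs V'"
        using hvecs_ex by metis
      have "(Y, U', V') \<in> blowup P"
        unfolding blowup_iff[OF Y] by (metis vec.scale_one)
      moreover have "fund_form Q (cmat (fst P) *v ?y) (cmat (snd P) *v ?y) = 0"
        using c(2)[of r] by (simp add: \<beta>_def \<gamma>_def)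
      ultimately have "(Y, U', V') \<in> off_centers P Q"
        using off_centers_iff[OF _ _ _ Y(2,3)] P.eq_center1[OF Y(1)] P.eq_center2[OF Y(1)] nz by blast
      then have "(Y, U', V') \<in> generic P Q"
        using off_centers_subset[of P Q] not1 not2 P.eq_epipole1[OF Y(2)] P.eq_epipole2[OF Y(3)]
          Q.eq_epipole1[OF Y(2)] Q.eq_epipole2[OF Y(3)]
        by (auto simp: generic_def cam1_def cam2_def)
      moreover have "\<Gamma> r \<in> bvecs (Y, U', V')"
        using Y c(1) s t by (simp add: \<Gamma>_def bvecs_iff hvecs_scale)
      ultimately show ?thesis
        using f(2) by blast
    qed
    then have "{r. f (\<Gamma> r) \<noteq> 0} \<subseteq> {r. c *s x + r *s c1 + r\<^sup>2 *s c2 \<in> \<Union>?\<L>}"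
      unfolding \<gamma>_def by blast
    then have "f (\<Gamma> 0) = 0"
      using zero_by_continuity[OF cont] finite_subset c(3) by blast
    then show "f w = 0"
      by (simp add: \<Gamma>_0)
  qed
qed

lemma strict_transform_subset_generic: "strict_transform P Q \<subseteq> zclosure bvecs (generic P Q)"
  using zclosure_minimal[OF off_centers_subset_generic] by (auto simp: strict_transform_eq)

text \<open>An equation f of the target is pulled back along triangulation to a polynomial on the
  source, where density of the generic points applies.\<close>

lemma conjugate_in_strict_transform:
  assumes z: "(X, U, V) \<in> strict_transform P Q" and Y: "(Y, U, V) \<in> blowup Q"
    and not: "\<not> (U = epipole1 Q \<and> V = epipole2 Q)"
  shows "(Y, U, V) \<in> strict_transform Q P"
proof -
  have "(Y, U, V) \<in> zclosure bvecs (off_centers Q P)"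
    unfolding in_zclosure_iff
  proof (intro ballI impI)
    fix f :: "bvec \<Rightarrow> complex" and w
    assume f: "f \<in> polyfun" "\<forall>q\<in>off_centers Q P. \<forall>v\<in>bvecs q. f v = 0" and w: "w \<in> bvecs (Y, U, V)"
    obtain y u v where w': "w = (y, u, v)" by (cases w)
    have y: "y \<in> hvecs Y" and u: "u \<in> hvecs U" and v: "v \<in> hvecs V"
      using w by (auto simp: w' bvecs_iff)
    obtain x where x: "x \<in> hvecs X"
      using hvecs_nonempty by blast
    obtain d :: "bvec \<Rightarrow> complex" and T :: "bvec \<Rightarrow> complex^4" where
      d: "d \<in> polyfun" "polymap T" "zero_homogeneous bvecs d"
        "\<And>w X. w \<in> bvecs (X, U, V) \<Longrightarrow> d w \<noteq> 0"
        "\<And>Y U V X w. (Y, U, V) \<in> blowup Q \<Longrightarrow> w \<in> bvecs (X, U, V) \<Longrightarrow> d w \<noteq> 0 \<Longrightarrow> T w \<in> hvecs Y"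
      by (rule Q.local_triangulation[OF not]) blast
    have w0: "(x, u, v) \<in> bvecs (X, U, V)"
      using x u v by (simp add: bvecs_iff)
    have d0: "d (x, u, v) \<noteq> 0"
      using d(4) w0 by blast
    then have "T (x, u, v) \<in> hvecs Y"
      using d(5)[OF Y w0] by blast
    then obtain c where c: "c \<noteq> 0" "y = c *s T (x, u, v)"
      using hvecs_iff y by blast
    let ?G = "\<lambda>w. (c *s T w, fst (snd w), snd (snd w))"
    \<comment> \<open>The scalar c makes triangulation hit the prescribed vector y at (x, u, v). The
      factor d kills the points where the formula degenerates; it is nonzero at (x, u, v) and can be
      cancelled at the end.\<close>
    let ?h = "\<lambda>w. d w * f (?G w)"
    have h: "?h \<in> polyfun"
      by (intro polyfun.mult d(1) polyfun_compose[OF f(1)] polymap_intros d(2) polyfun.const)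
    have vanish: "?h w = 0" if q: "q \<in> generic P Q" and w: "w \<in> bvecs q" for q w
    proof (cases "d w = 0")
      case False
      obtain X' U' V' where q': "q = (X', U', V')" by (cases q)
      obtain x' u' v' where w': "w = (x', u', v')" by (cases w)
      have u': "u' \<in> hvecs U'" and v': "v' \<in> hvecs V'"
        using w by (auto simp: w' q' bvecs_iff)
      have strict: "(X', U', V') \<in> strict_transform P Q"
        using q by (simp add: generic_def q')
      obtain Y' where Y': "(Y', U', V') \<in> blowup Q"
        using blowup_exists[OF strict_transform_fund_form[OF strict u' v'] u' v'] .
      have "(X', U', V') \<in> blowup P"
        using strict by (simp add: strict_transform_def)
      then have "fund_form P u' v' = 0"
        using blowup_fund_form u' v' by blast
      then have "(Y', U', V') \<in> off_centers Q P"
        using two_pairs.generic_off_centers[OF exchange Y' u' v'] q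
        by (simp add: generic_def q' cam1_def cam2_def)
      moreover have "T w \<in> hvecs Y'"
        using d(5)[OF Y'] w False by (simp add: q')
      then have "?G w \<in> bvecs (Y', U', V')"
        using c(1) u' v' by (simp add: bvecs_iff w' hvecs_scale)
      ultimately show ?thesis
        using f(2) by simp
    qed simp
    have "(X, U, V) \<in> zclosure bvecs (generic P Q)"
      using strict_transform_subset_generic z by blast
    from zclosureD[OF this h vanish w0] have "?h (x, u, v) = 0" .
    then show "f w = 0"
      using d0 c(2) by (simp add: w')
  qed
  then show ?thesis
    using Y by (simp add: strict_transform_eq)
qed

section \<open>Existence and uniqueness of conjugates\<close>

lemma incidence_iff: "((X, U, V), y) \<in> incidence P Q \<longleftrightarrow>
    (\<exists>Y. y = (Y, U, V) \<and> (X, U, V) \<in> strict_transform P Q \<and> (Y, U, V) \<in> strict_transform Q P)"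
  by (cases y) (auto simp: incidence_def joint_camera_map_def cam1_def cam2_def)

lemma strict_transform_blowup: "z \<in> strict_transform P Q \<Longrightarrow> z \<in> blowup P"
  by (simp add: strict_transform_def)

lemma conjugate_unique:
  assumes "\<not> (U = epipole1 Q \<and> V = epipole2 Q)"
    and "((X, U, V), y) \<in> incidence P Q" "((X', U, V), y') \<in> incidence P Q"
  shows "y = y'"
  using assms Q.blowup_unique two_pairs.strict_transform_blowup[OF exchange]
  unfolding incidence_iff by blast

lemma conjugate_exists:
  assumes z: "(X, U, V) \<in> strict_transform P Q" and not: "\<not> (U = epipole1 Q \<and> V = epipole2 Q)"
  obtains Y where "((X, U, V), (Y, U, V)) \<in> incidence P Q"
proof -
  obtain x u v where w: "x \<in> hvecs X" "u \<in> hvecs U" "v \<in> hvecs V"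
    using bvecs_ex by blast
  obtain Y where Y: "(Y, U, V) \<in> blowup Q"
    using blowup_exists[OF strict_transform_fund_form[OF z w(2,3)] w(2,3)] .
  then show thesis
    using that z conjugate_in_strict_transform[OF z Y not] by (simp add: incidence_iff)
qed

text \<open>Over the pair of epipoles of Q all points of the baseline other than the centers are
  conjugate to z: they project to the epipoles, and the form of P vanishes there because z lies in
  the blow-up for P.\<close>

lemma conjugate_not_unique:
  assumes z: "(X, U, V) \<in> strict_transform P Q" and U: "U = epipole1 Q" and V: "V = epipole2 Q"
  shows "\<not> (\<exists>!y. ((X, U, V), y) \<in> incidence P Q)"
proof -
  have u: "cmat (fst Q) *v b' \<in> hvecs U" and v: "cmat (snd Q) *v a' \<in> hvecs V"
    using Q.epipole1 Q.epipole2 by (simp_all add: U V)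
  have F: "fund_form P (cmat (fst Q) *v b') (cmat (snd Q) *v a') = 0"
    using z strict_transform_blowup blowup_fund_form u v by blast
  have baseline: "\<exists>Y. r *s a' + b' \<in> hvecs Y \<and> ((X, U, V), (Y, U, V)) \<in> incidence P Q" if "r \<noteq> 0" for r
  proof -
    have 1: "cmat (fst Q) *v (r *s a' + b') = 1 *s (cmat (fst Q) *v b')"
      and 2: "cmat (snd Q) *v (r *s a' + b') = r *s (cmat (snd Q) *v a')"
      by (simp_all add: matrix_vector_right_distrib vector_scalar_commute Q.A_a Q.B_b)
    have "r *s a' + b' \<noteq> 0"
      using 1 Q.A_b_nonzero by auto
    then obtain Y where Y: "r *s a' + b' \<in> hvecs Y"
      using hvecs_ex by blast
    have "(Y, U, V) \<in> blowup Q"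
      unfolding blowup_iff[OF Y u v] using 1 2 by blast
    moreover have "Y \<noteq> center (fst Q)" "Y \<noteq> center (snd Q)"
      unfolding Q.eq_center1[OF Y] Q.eq_center2[OF Y] 1 2
      using that Q.A_b_nonzero Q.B_a_nonzero by auto
    ultimately have "(Y, U, V) \<in> off_centers Q P"
      using two_pairs.off_centers_iff[OF exchange _ _ _ u v] F by blast
    then show ?thesis
      using Y z off_centers_subset[of Q P] unfolding incidence_iff by blast
  qed
  \<comment> \<open>Any two distinct nonzero parameters give two different points of the
    baseline.\<close>
  obtain Y Y' where Y: "1 *s a' + b' \<in> hvecs Y" "((X, U, V), (Y, U, V)) \<in> incidence P Q"
    and Y': "2 *s a' + b' \<in> hvecs Y'" "((X, U, V), (Y', U, V)) \<in> incidence P Q"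
    using baseline[of 1] baseline[of 2] by auto
  have "Y \<noteq> Y'"
  proof
    assume "Y = Y'"
    then obtain c where c: "2 *s a' + b' = c *s (1 *s a' + b')"
      using Y(1) Y'(1) hvecs_iff by blast
    have "cmat (fst Q) *v b' = c *s (cmat (fst Q) *v b')"
      using arg_cong[OF c, of "(*v) (cmat (fst Q))"]
      by (simp add: matrix_vector_right_distrib vector_scalar_commute Q.A_a)
    then have "c = 1"
      using Q.A_b_nonzero by (metis vec.scale_cancel_right vec.scale_one)
    then have "2 *s a' = 1 *s a'"
      using c by simp
    then show False
      using Q.nonzero(1) by (metis one_eq_numeral_iff semiring_norm(85) vec.scale_cancel_right)
  qed
  then show ?thesis
    using Y(2) Y'(2) by blast
qed

lemma psi_domain_eq: "psi_domain P Q = strict_transform P Q - ({z. cam1 z = epipole1 Q} \<inter> {z. cam2 z = epipole2 Q})"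
proof (intro set_eqI)
  fix z :: bpoint
  obtain X U V where z: "z = (X, U, V)" by (cases z)
  show "z \<in> psi_domain P Q \<longleftrightarrow> z \<in> strict_transform P Q - ({z. cam1 z = epipole1 Q} \<inter> {z. cam2 z = epipole2 Q})"
  proof (cases "U = epipole1 Q \<and> V = epipole2 Q")
    case True
    then show ?thesis
      using conjugate_not_unique[of X U V] by (auto simp: z psi_domain_def cam1_def cam2_def)
  next
    case False
    have "\<exists>!y. ((X, U, V), y) \<in> incidence P Q" if strict: "(X, U, V) \<in> strict_transform P Q"
    proof -
      obtain Y where "((X, U, V), (Y, U, V)) \<in> incidence P Q"
        using conjugate_exists[OF strict False] .
      then show ?thesis
        using conjugate_unique[OF False] by blast
    qed
    then show ?thesis
      using False by (auto simp: z psi_domain_def cam1_def cam2_def)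
  qed
qed

lemma psi_incidence: "z \<in> psi_domain P Q \<Longrightarrow> (z, psi P Q z) \<in> incidence P Q"
  unfolding psi_domain_def psi_def by (auto intro: theI')

lemma psi_eqI: "z \<in> psi_domain P Q \<Longrightarrow> (z, y) \<in> incidence P Q \<Longrightarrow> psi P Q z = y"
  using psi_incidence unfolding psi_domain_def by blast

lemma psi_local:
  assumes "z \<in> psi_domain P Q"
  obtains Z and T :: "bvec \<Rightarrow> complex^4"
  where "zclosed bvecs Z" "z \<notin> Z" "polymap T"
    and "\<And>q w. q \<in> psi_domain P Q - Z \<Longrightarrow> w \<in> bvecs q \<Longrightarrow> (T w, fst (snd w), snd (snd w)) \<in> bvecs (psi P Q q)"
proof -
  obtain X U V where z: "z = (X, U, V)" by (cases z)
  have not: "\<not> (U = epipole1 Q \<and> V = epipole2 Q)"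
    using assms by (auto simp: psi_domain_eq z cam1_def cam2_def)
  obtain d :: "bvec \<Rightarrow> complex" and T :: "bvec \<Rightarrow> complex^4" where
    d: "d \<in> polyfun" "polymap T" "zero_homogeneous bvecs d"
      "\<And>w X. w \<in> bvecs (X, U, V) \<Longrightarrow> d w \<noteq> 0"
      "\<And>Y U V X w. (Y, U, V) \<in> blowup Q \<Longrightarrow> w \<in> bvecs (X, U, V) \<Longrightarrow> d w \<noteq> 0 \<Longrightarrow> T w \<in> hvecs Y"
    by (rule Q.local_triangulation[OF not]) blast
  show thesis
  proof (rule that[of "zero_locus bvecs {d}" T])
    show "zclosed bvecs (zero_locus bvecs {d})"
      using d(1) by (auto simp: zclosed_def)
    show "z \<notin> zero_locus bvecs {d}"
    proof -
      obtain x u v where "x \<in> hvecs X" "u \<in> hvecs U" "v \<in> hvecs V"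
        using bvecs_ex by blast
      then have "(x, u, v) \<in> bvecs (X, U, V)"
        by (simp add: bvecs_iff)
      then show ?thesis
        using d(4) unfolding z not_in_zero_locus_iff by blast
    qed
    show "polymap T" by (rule d(2))
    fix q w assume q: "q \<in> psi_domain P Q - zero_locus bvecs {d}" and w: "w \<in> bvecs q"
    obtain X' U' V' where q': "q = (X', U', V')" by (cases q)
    obtain Y where Y: "psi P Q q = (Y, U', V')" "(Y, U', V') \<in> strict_transform Q P"
      using psi_incidence[of q] q by (auto simp: q' incidence_iff)
    have "d w \<noteq> 0"
      using q w d(3) unfolding Diff_iff not_in_zero_locus_iff zero_homogeneous_def by blast
    then have "T w \<in> hvecs Y"
      using d(5)[OF two_pairs.strict_transform_blowup[OF exchange Y(2)]] w by (simp add: q')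
    then show "(T w, fst (snd w), snd (snd w)) \<in> bvecs (psi P Q q)"
      unfolding Y(1) using w by (cases w) (simp add: q' bvecs_iff)
  qed
qed

end

section \<open>The conjugation map\<close>

lemma quadric_form_has_derivative:
  "(quadric_form P Q has_derivative (\<lambda>h.
      fund_form Q (cmat (fst P) *v h) (cmat (snd P) *v x)
    + fund_form Q (cmat (fst P) *v x) (cmat (snd P) *v h))) (at x)"
  unfolding quadric_form_def[abs_def]
  by (intro fund_form_has_derivative bounded_linear_imp_has_derivative matrix_vector_mul_bounded_linear)

lemma quadric_singular_iff:
  "quadric_singular P Q \<longleftrightarrow> (\<exists>x. x \<noteq> 0 \<and> (\<forall>h.
      fund_form Q (cmat (fst P) *v h) (cmat (snd P) *v x)
    + fund_form Q (cmat (fst P) *v x) (cmat (snd P) *v h) = 0))" (is "_ \<longleftrightarrow> (\<exists>x. x \<noteq> 0 \<and> ?crit x)")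
proof -
  have "(quadric_form P Q has_derivative (\<lambda>_. 0)) (at x) \<longleftrightarrow> ?crit x" for x
    using has_derivative_unique[OF quadric_form_has_derivative[of P Q x], of "\<lambda>_. 0"]
      quadric_form_has_derivative[of P Q x] by (auto simp: fun_eq_iff)
  \<comment> \<open>Euler's relation: for h = x the criterion reads that twice the form vanishes, so
    a critical point lies on the quadric.\<close>
  moreover have "quadric_form P Q x = 0" if "?crit x" for x
    using that[rule_format, of x] by (simp add: quadric_form_def)
  ultimately show ?thesis
    unfolding quadric_singular_def by blast
qed

context two_pairs
begin

lemma psi_conjugate:
  assumes "(X, U, V) \<in> psi_domain P Q"
  obtains Y where "psi P Q (X, U, V) = (Y, U, V)" "(Y, U, V) \<in> strict_transform Q P"
  using psi_incidence[OF assms] that unfolding incidence_iff by blast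

lemma psi_maps_to: "psi P Q ` psi_domain P Q \<subseteq> strict_transform Q P"
  using psi_incidence by (force simp: incidence_def)

lemma regular_psi: "regular_map bvecs bvecs (psi_domain P Q) (strict_transform Q P) (psi P Q)"
  unfolding regular_map_def
proof (intro conjI ballI psi_maps_to)
  fix z assume "z \<in> psi_domain P Q"
  then obtain Z and T :: "bvec \<Rightarrow> complex^4" where ZT: "zclosed bvecs Z" "z \<notin> Z" "polymap T"
    "\<And>q w. q \<in> psi_domain P Q - Z \<Longrightarrow> w \<in> bvecs q \<Longrightarrow> (T w, fst (snd w), snd (snd w)) \<in> bvecs (psi P Q q)"
    by (rule psi_local) blast
  have "polymap (\<lambda>w. (T w, fst (snd w), snd (snd w)))"
    by (intro polymap_intros ZT(3))
  then show "\<exists>Z G. zclosed bvecs Z \<and> z \<notin> Z \<and> (\<forall>c\<in>coord_fun. (\<lambda>v. c (G v)) \<in> polyfun) \<and>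
      (\<forall>q\<in>psi_domain P Q - Z. \<forall>v\<in>bvecs q. G v \<in> bvecs (psi P Q q))"
    using ZT unfolding polymap_def
    by (intro exI[of _ Z] exI[of _ "\<lambda>w. (T w, fst (snd w), snd (snd w))"]) blast
qed

section \<open>Birationality of the conjugation map and the smooth case\<close>

lemma generic_subset_psi_domain: "generic P Q \<subseteq> psi_domain P Q"
  by (auto simp: generic_def psi_domain_eq)

lemma dense_open_psi_domain: "zopen_dense_in bvecs (psi_domain P Q) (strict_transform P Q)"
  unfolding zopen_dense_in_def
proof
  show "\<exists>Z. zclosed bvecs Z \<and> psi_domain P Q = strict_transform P Q - Z"
    unfolding psi_domain_eq by (metis hclosed_imp_zclosed hclosed_Int hclosed_cam1 hclosed_cam2)
  show "strict_transform P Q \<subseteq> zclosure bvecs (psi_domain P Q)"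
    using strict_transform_subset_generic zclosure_mono[OF generic_subset_psi_domain] by blast
qed

lemma dense_open_generic: "zopen_dense_in bvecs (generic P Q) (strict_transform P Q)"
  unfolding zopen_dense_in_def
proof
  show "\<exists>Z. zclosed bvecs Z \<and> generic P Q = strict_transform P Q - Z"
    unfolding generic_def
    by (rule exI, rule conjI[OF _ refl]) (intro hclosed_imp_zclosed hclosed_Un hclosed_cam1 hclosed_cam2)
qed (rule strict_transform_subset_generic)

text \<open>Conjugation preserves both images, on which genericity depends, and the incidence
  relation is symmetric.\<close>

lemma psi_generic:
  assumes "z \<in> generic P Q"
  shows "psi P Q z \<in> generic Q P" "psi Q P (psi P Q z) = z"
proof -
  interpret exchange: two_pairs Q a' b' R' S' P a b R S
    by (rule exchange)
  have inc: "(z, psi P Q z) \<in> incidence P Q"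
    using assms generic_subset_psi_domain psi_incidence by blast
  then show gen: "psi P Q z \<in> generic Q P"
    using assms by (auto simp: generic_def incidence_def joint_camera_map_def)
  have "(psi P Q z, z) \<in> incidence Q P"
    using inc by (auto simp: incidence_def)
  then show "psi Q P (psi P Q z) = z"
    using exchange.psi_eqI exchange.generic_subset_psi_domain gen by blast
qed

lemma iso_generic: "variety_iso bvecs bvecs (generic P Q) (generic Q P) (psi P Q)"
proof -
  interpret exchange: two_pairs Q a' b' R' S' P a b R S
    by (rule exchange)
  have bij: "bij_betw (psi P Q) (generic P Q) (generic Q P)"
    by (rule bij_betw_byWitness[where f' = "psi Q P"]) (use psi_generic exchange.psi_generic in auto)
  have inv: "psi Q P y = inv_into (generic P Q) (psi P Q) y" if "y \<in> generic Q P" for y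
  proof -
    have "psi P Q (psi Q P y) = y" "psi Q P y \<in> generic P Q"
      using exchange.psi_generic that by auto
    then show ?thesis
      using inv_into_f_f[OF bij_betw_imp_inj_on[OF bij]] by metis
  qed
  have "regular_map bvecs bvecs (generic P Q) (generic Q P) (psi P Q)"
    by (rule regular_map_subset[OF regular_psi generic_subset_psi_domain]) (use psi_generic(1) in blast)
  moreover have "regular_map bvecs bvecs (generic Q P) (generic P Q) (psi Q P)"
    by (rule regular_map_subset[OF exchange.regular_psi exchange.generic_subset_psi_domain])
      (use exchange.psi_generic(1) in blast)
  then have "regular_map bvecs bvecs (generic Q P) (generic P Q) (inv_into (generic P Q) (psi P Q))"
    by (rule regular_map_cong) (rule inv)
  ultimately show ?thesis
    using bij by (simp add: variety_iso_def)
qed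

lemma birational_psi:
  "birational_map bvecs bvecs (strict_transform P Q) (strict_transform Q P) (psi_domain P Q) (psi P Q)"
  unfolding birational_map_def
  using dense_open_psi_domain regular_psi dense_open_generic two_pairs.dense_open_generic[OF exchange]
    generic_subset_psi_domain iso_generic by blast

lemma smooth_imp_psi_domain:
  assumes "strict_transform_smooth P Q"
  shows "psi_domain P Q = strict_transform P Q"
proof -
  have False if z: "z \<in> strict_transform P Q" and U: "cam1 z = epipole1 Q" and V: "cam2 z = epipole2 Q" for z
  proof -
    obtain X where z': "z = (X, epipole1 Q, epipole2 Q)"
      using U V by (cases z) (auto simp: cam1_def cam2_def)
    obtain x where x: "x \<in> hvecs X"
      using hvecs_nonempty by blast
    let ?w = "(x, cmat (fst Q) *v b', cmat (snd Q) *v a')"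
    have "?w \<in> bvecs z"
      using x Q.epipole1 Q.epipole2 by (simp add: z' bvecs_iff)
    then obtain h where h: "frechet_derivative (\<lambda>(x, u, v). fund_form Q u v) (at ?w) h \<noteq> 0"
      using assms z unfolding strict_transform_smooth_def by blast
    have "((\<lambda>w :: bvec. fund_form Q (fst (snd w)) (snd (snd w))) has_derivative
        (\<lambda>h. fund_form Q (fst (snd h)) (snd (snd ?w)) + fund_form Q (fst (snd ?w)) (snd (snd h)))) (at ?w)"
      by (intro fund_form_has_derivative derivative_intros)
    \<comment> \<open>By the product rule the derivative has one summand with each epipole of Q in
      its slot, and both vanish identically.\<close>
    then have "((\<lambda>(x, u, v). fund_form Q u v) has_derivative (\<lambda>h :: bvec. 0)) (at ?w)"
      by (simp add: Q.fund_form_epipole1 Q.fund_form_epipole2 case_prod_unfold)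
    then show False
      using h frechet_derivative_at by metis
  qed
  then show ?thesis
    unfolding psi_domain_eq by blast
qed

text \<open>When conjugates exist uniquely everywhere, the incidence variety is the graph of
  \<open>psi P Q\<close>. The inverse of the projection is z \<mapsto> (z, psi P Q z), which is
  regular by local triangulation.\<close>

lemma iso_fst:
  assumes "psi_domain P Q = strict_transform P Q"
  shows "variety_iso bbvecs bvecs (incidence P Q) (strict_transform P Q) fst"
proof -
  have inc: "(z, y) \<in> incidence P Q \<longleftrightarrow> z \<in> strict_transform P Q \<and> y = psi P Q z" for z y
  proof
    assume inc: "(z, y) \<in> incidence P Q"
    then have "z \<in> strict_transform P Q"
      by (simp add: incidence_def)
    then show "z \<in> strict_transform P Q \<and> y = psi P Q z"
      using psi_eqI[OF _ inc] assms by simp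
  qed (use psi_incidence assms in blast)
  have bij: "bij_betw fst (incidence P Q) (strict_transform P Q)"
    by (rule bij_betw_byWitness[where f' = "\<lambda>z. (z, psi P Q z)"]) (auto simp: inc)
  have inv: "(z, psi P Q z) = inv_into (incidence P Q) fst z" if "z \<in> strict_transform P Q" for z
    using inv_into_f_f[OF bij_betw_imp_inj_on[OF bij], of "(z, psi P Q z)"] that by (simp add: inc)
  have "regular_map bbvecs bvecs (incidence P Q) (strict_transform P Q) fst"
    unfolding regular_map_def
  proof (intro conjI ballI)
    show "fst ` incidence P Q \<subseteq> strict_transform P Q"
      by (auto simp: inc)
    fix p :: "bpoint \<times> bpoint"
    have "hvecs x \<noteq> {}" "hvecs u \<noteq> {}" for x :: "4 proj" and u :: "3 proj"
      using hvecs_nonempty[of x] hvecs_nonempty[of u] by auto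
    then have "bbvecs p \<noteq> {}" for p
      by (cases p) (simp add: bbvecs_def bvecs_def case_prod_unfold)
    then have "zclosed bbvecs ({} :: (bpoint \<times> bpoint) set)"
      by (rule zclosed_empty)
    moreover have "polymap (\<lambda>w :: bvec \<times> bvec. fst w)"
      by (intro polymap_intros)
    ultimately show "\<exists>Z G. zclosed bbvecs Z \<and> p \<notin> Z \<and> (\<forall>c\<in>coord_fun. (\<lambda>v. c (G v)) \<in> polyfun) \<and>
       (\<forall>q\<in>incidence P Q - Z. \<forall>v\<in>bbvecs q. G v \<in> bvecs (fst q))"
      by (intro exI[of _ "{}"] exI[of _ fst]) (auto simp: polymap_def bbvecs_def)
  qed
  moreover have "regular_map bvecs bbvecs (strict_transform P Q) (incidence P Q) (\<lambda>z. (z, psi P Q z))"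
    unfolding regular_map_def
  proof (intro conjI ballI)
    show "(\<lambda>z. (z, psi P Q z)) ` strict_transform P Q \<subseteq> incidence P Q"
      by (auto simp: inc)
    fix z assume "z \<in> strict_transform P Q"
    then have "z \<in> psi_domain P Q"
      using assms by simp
    then obtain Z and T :: "bvec \<Rightarrow> complex^4" where ZT: "zclosed bvecs Z" "z \<notin> Z" "polymap T"
      "\<And>q w. q \<in> psi_domain P Q - Z \<Longrightarrow> w \<in> bvecs q \<Longrightarrow> (T w, fst (snd w), snd (snd w)) \<in> bvecs (psi P Q q)"
      by (rule psi_local) blast
    let ?G = "\<lambda>w. (w, T w, fst (snd w), snd (snd w))"
    have "polymap ?G"
      by (intro polymap_intros ZT(3))
    moreover have "?G w \<in> bbvecs (q, psi P Q q)" if "q \<in> strict_transform P Q - Z" "w \<in> bvecs q" for q w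
      using ZT(4)[of q w] that assms by (simp add: bbvecs_def)
    ultimately show "\<exists>Z G. zclosed bvecs Z \<and> z \<notin> Z \<and> (\<forall>c\<in>coord_fun. (\<lambda>v. c (G v)) \<in> polyfun) \<and>
       (\<forall>q\<in>strict_transform P Q - Z. \<forall>v\<in>bvecs q. G v \<in> bbvecs (q, psi P Q q))"
      using ZT(1,2) unfolding polymap_def by (intro exI[of _ Z] exI[of _ ?G]) blast
  qed
  then have "regular_map bvecs bbvecs (strict_transform P Q) (incidence P Q) (inv_into (incidence P Q) fst)"
    by (rule regular_map_cong) (rule inv)
  ultimately show ?thesis
    using bij by (simp add: variety_iso_def)
qed

section \<open>Singular points of the quadric and the baseline of the other pair\<close>

lemma epipoles_fund_form_iff_singular:
  "quadric_singular P Q \<longleftrightarrow> fund_form P (cmat (fst Q) *v b') (cmat (snd Q) *v a') = 0"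
proof
  assume "fund_form P (cmat (fst Q) *v b') (cmat (snd Q) *v a') = 0"
  then obtain x s t where x: "x \<noteq> 0 \<or> s \<noteq> 0 \<or> t \<noteq> 0"
    "cmat (fst P) *v x = s *s (cmat (fst Q) *v b')" "cmat (snd P) *v x = t *s (cmat (snd Q) *v a')"
    unfolding fund_form_eq_0_iff by blast
  \<comment> \<open>The point x, whose images are multiples of the epipoles of Q, is the critical
    point: both summands of the derivative contain an epipole.\<close>
  have "x \<noteq> 0"
    using x Q.A_b_nonzero Q.B_a_nonzero by auto
  then show "quadric_singular P Q"
    unfolding quadric_singular_iff
    by (intro exI[of _ x])
      (simp add: x fund_form_bilinear Q.fund_form_epipole1 Q.fund_form_epipole2)
next
  assume "quadric_singular P Q"
  then obtain x where x: "x \<noteq> 0" and crit: "\<And>h. fund_form Q (cmat (fst P) *v h) (cmat (snd P) *v x)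
    + fund_form Q (cmat (fst P) *v x) (cmat (snd P) *v h) = 0"
    unfolding quadric_singular_iff by blast
  \<comment> \<open>l and m are the coefficient vectors of the two linear forms in the derivative at
    x. Criticality says that (l, m) annihilates the camera columns of P; it annihilates the epipole
    columns because the form of Q vanishes at its epipoles.\<close>
  define l where "l = (\<chi> i. fund_form Q (axis i 1) (cmat (snd P) *v x))"
  define m where "m = (\<chi> i. fund_form Q (cmat (fst P) *v x) (axis i 1))"
  have l: "(\<Sum>i\<in>UNIV. l $ i * u $ i) = fund_form Q u (cmat (snd P) *v x)" for u
    by (subst fund_form_linear_left) (simp add: l_def mult.commute)
  have m: "(\<Sum>i\<in>UNIV. m $ i * v $ i) = fund_form Q (cmat (fst P) *v x) v" for v
    by (subst fund_form_linear_right) (simp add: m_def)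
  show "fund_form P (cmat (fst Q) *v b') (cmat (snd Q) *v a') = 0"
  proof (cases "l = 0 \<and> m = 0")
    case True
    then have "fund_form Q u (cmat (snd P) *v x) = 0" "fund_form Q (cmat (fst P) *v x) v = 0" for u v
      unfolding l[symmetric] m[symmetric] by simp_all
    then obtain c d where "cmat (snd P) *v x = c *s (cmat (snd Q) *v a')" "cmat (fst P) *v x = d *s (cmat (fst Q) *v b')"
      using Q.fund_form_left_kernel Q.fund_form_right_kernel by metis
    then show ?thesis
      unfolding fund_form_eq_0_iff using x by blast
  next
    case False
    then show ?thesis
      using crit by (intro fund_form_eq_0I_left[of l m])
        (auto simp: l m Q.fund_form_epipole1 Q.fund_form_epipole2)
  qed
qed

text \<open>The point r q1 + s q2 has images s times the first and r times the second epipole, so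
  the quadric restricts to r s times a constant on the baseline. One point off the centers, r = s =
  1, detects the constant.\<close>

lemma baseline_in_quadric_iff:
  "proj_line (center (fst Q)) (center (snd Q)) \<subseteq> quadric Q P \<longleftrightarrow>
    fund_form P (cmat (fst Q) *v b') (cmat (snd Q) *v a') = 0"
proof -
  have quad: "quadric_form Q P (r *s a' + s *s b') = s * r * fund_form P (cmat (fst Q) *v b') (cmat (snd Q) *v a')" for r s
    by (simp add: quadric_form_def matrix_vector_right_distrib vector_scalar_commute Q.A_a Q.B_b
        fund_form_bilinear)
  have line: "X \<in> proj_line (center (fst Q)) (center (snd Q)) \<longleftrightarrow> (\<exists>r s. x = r *s a' + s *s b')"
    if x: "x \<in> hvecs X" for X x
  proof -
    have "vec.span (vec.span {a'} \<union> vec.span {b'}) = vec.span {a', b'}"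
    proof (rule subset_antisym)
      show "vec.span (vec.span {a'} \<union> vec.span {b'}) \<subseteq> vec.span {a', b'}"
        using vec.span_mono[of "{a'}" "{a', b'}"] vec.span_mono[of "{b'}" "{a', b'}"]
        by (intro vec.span_minimal vec.subspace_span) simp
      show "vec.span {a', b'} \<subseteq> vec.span (vec.span {a'} \<union> vec.span {b'})"
        by (rule vec.span_mono) (auto intro: vec.span_base)
    qed
    then have "X \<in> proj_line (center (fst Q)) (center (snd Q)) \<longleftrightarrow> vec.span {x} \<subseteq> vec.span {a', b'}"
      by (simp add: proj_line_def Rep_proj_span[OF x] Rep_proj_span[OF Q.a_center] Rep_proj_span[OF Q.b_center])
    also have "\<dots> \<longleftrightarrow> x \<in> vec.span {a', b'}"
      using vec.span_minimal[of "{x}"] vec.span_base[of x "{x}"] by auto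
    also have "\<dots> \<longleftrightarrow> (\<exists>r s. x = r *s a' + s *s b')"
      by (simp add: vec.span_insert span_single algebra_simps)
    finally show ?thesis .
  qed
  show ?thesis
  proof
    assume sub: "proj_line (center (fst Q)) (center (snd Q)) \<subseteq> quadric Q P"
    have "1 *s a' + 1 *s b' \<noteq> 0"
      using Q.independent[of "- 1"] by (simp add: add_eq_0_iff)
    then obtain X where X: "1 *s a' + 1 *s b' \<in> hvecs X"
      using hvecs_ex by blast
    then have "X \<in> quadric Q P"
      using sub line by blast
    then show "fund_form P (cmat (fst Q) *v b') (cmat (snd Q) *v a') = 0"
      using quad[of 1 1] quadric_iff[OF X] by simp
  next
    assume F: "fund_form P (cmat (fst Q) *v b') (cmat (snd Q) *v a') = 0"
    show "proj_line (center (fst Q)) (center (snd Q)) \<subseteq> quadric Q P"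
    proof
      fix X assume X: "X \<in> proj_line (center (fst Q)) (center (snd Q))"
      obtain x where x: "x \<in> hvecs X"
        using hvecs_nonempty by blast
      then show "X \<in> quadric Q P"
        using X line[OF x] quadric_iff[OF x] quad F by auto
    qed
  qed
qed

section \<open>Conjugates of points on the epipolar lines\<close>

lemma psi_epi_line1:
  assumes "z \<in> strict_transform P Q" "z \<in> epi_line1 P Q - epi_line2 P Q"
  shows "z \<in> psi_domain P Q" "psi P Q z \<in> exc_divisor Q (center (snd Q))"
proof -
  obtain X U V where z: "z = (X, U, V)" by (cases z)
  have U: "U = epipole1 Q" and V: "V \<noteq> epipole2 Q"
    using assms by (auto simp: z epi_line1_def epi_line2_def cam1_def cam2_def)
  show dom: "z \<in> psi_domain P Q"
    using assms V by (simp add: psi_domain_eq z cam1_def cam2_def)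
  then obtain Y where Y: "psi P Q z = (Y, U, V)" "(Y, U, V) \<in> strict_transform Q P"
    using psi_conjugate[of X U V] unfolding z by blast
  have blow: "(Y, U, V) \<in> blowup Q"
    using two_pairs.strict_transform_blowup[OF exchange Y(2)] .
  obtain v where v: "v \<in> hvecs V"
    using hvecs_nonempty by blast
  have u: "cmat (fst Q) *v b' \<in> hvecs U"
    using Q.epipole1 U by simp
  \<comment> \<open>The center q2 lies on the ray of the first epipole, and its second
    proportionality holds with scalar 0 for every v. Uniqueness on the blow-up leaves no other
    conjugate.\<close>
  have "(center (snd Q), U, V) \<in> blowup Q"
    unfolding blowup_iff[OF Q.b_center u v] Q.B_b by (metis vec.scale_one vec.scale_zero_left)
  then have "Y = center (snd Q)"
    using Q.blowup_unique[OF blow] V by blast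
  then show "psi P Q z \<in> exc_divisor Q (center (snd Q))"
    using blow by (simp add: Y exc_divisor_def blowdown_def)
qed

lemma psi_epi_line2:
  assumes "z \<in> strict_transform P Q" "z \<in> epi_line2 P Q - epi_line1 P Q"
  shows "z \<in> psi_domain P Q" "psi P Q z \<in> exc_divisor Q (center (fst Q))"
proof -
  obtain X U V where z: "z = (X, U, V)" by (cases z)
  have V: "V = epipole2 Q" and U: "U \<noteq> epipole1 Q"
    using assms by (auto simp: z epi_line1_def epi_line2_def cam1_def cam2_def)
  show dom: "z \<in> psi_domain P Q"
    using assms U by (simp add: psi_domain_eq z cam1_def cam2_def)
  then obtain Y where Y: "psi P Q z = (Y, U, V)" "(Y, U, V) \<in> strict_transform Q P"
    using psi_conjugate[of X U V] unfolding z by blast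
  have blow: "(Y, U, V) \<in> blowup Q"
    using two_pairs.strict_transform_blowup[OF exchange Y(2)] .
  obtain u where u: "u \<in> hvecs U"
    using hvecs_nonempty by blast
  have v: "cmat (snd Q) *v a' \<in> hvecs V"
    using Q.epipole2 V by simp
  have "(center (fst Q), U, V) \<in> blowup Q"
    unfolding blowup_iff[OF Q.a_center u v] Q.A_a by (metis vec.scale_one vec.scale_zero_left)
  then have "Y = center (fst Q)"
    using Q.blowup_unique[OF blow] U by blast
  then show "psi P Q z \<in> exc_divisor Q (center (fst Q))"
    using blow by (simp add: Y exc_divisor_def blowdown_def)
qed

lemma blowdown_inj:
  assumes "(X, U, V) \<in> blowup P" "(X, U', V') \<in> blowup P" "X \<noteq> center (fst P)" "X \<noteq> center (snd P)"
  shows "U = U' \<and> V = V'"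
proof -
  obtain x u v where w: "x \<in> hvecs X" "u \<in> hvecs U" "v \<in> hvecs V"
    using bvecs_ex by blast
  obtain s t where "cmat (fst P) *v x = s *s u" "cmat (snd P) *v x = t *s v"
    using assms(1) blowup_iff[OF w] by blast
  moreover have nz: "cmat (fst P) *v x \<noteq> 0" "cmat (snd P) *v x \<noteq> 0"
    using P.eq_center1[OF w(1)] P.eq_center2[OF w(1)] assms(3,4) by auto
  ultimately have 1: "cmat (fst P) *v x \<in> hvecs U" "cmat (snd P) *v x \<in> hvecs V"
    using hvecs_iff[OF w(2)] hvecs_iff[OF w(3)] by (metis vec.scale_zero_left)+
  obtain u' where u': "u' \<in> hvecs U'"
    using hvecs_nonempty by blast
  obtain v' where v': "v' \<in> hvecs V'"
    using hvecs_nonempty by blast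
  obtain s t where "cmat (fst P) *v x = s *s u'" "cmat (snd P) *v x = t *s v'"
    using assms(2) blowup_iff[OF w(1) u' v'] by blast
  then have "cmat (fst P) *v x \<in> hvecs U'" "cmat (snd P) *v x \<in> hvecs V'"
    using nz hvecs_iff[OF u'] hvecs_iff[OF v'] by (metis vec.scale_zero_left)+
  then show ?thesis
    using 1 hvecs_cong by blast
qed

text \<open>Off both centers the blow-down is injective, so X has a single lift and its conjugates
  come from that lift alone.\<close>

lemma down_conjugates_eq:
  assumes "(X, U, V) \<in> strict_transform P Q" "(X, U, V) \<in> psi_domain P Q"
    and "X \<noteq> center (fst P)" "X \<noteq> center (snd P)"
  shows "down_conjugates P Q X = {blowdown (psi P Q (X, U, V))}"
proof -
  have "y = psi P Q (X, U, V)" if inc: "(z, y) \<in> incidence P Q" and X: "blowdown z = X" for z y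
  proof -
    obtain U' V' where z: "z = (X, U', V')"
      using X by (cases z) (auto simp: blowdown_def)
    then have "(X, U', V') \<in> blowup P"
      using inc strict_transform_blowup by (auto simp: incidence_def)
    then have "z = (X, U, V)"
      using blowdown_inj[OF strict_transform_blowup[OF assms(1)]] assms(3,4) z by blast
    then show ?thesis
      using psi_eqI[OF assms(2)] inc by simp
  qed
  moreover have "blowdown (X, U, V) = X"
    by (simp add: blowdown_def)
  ultimately show ?thesis
    using psi_incidence[OF assms(2)] unfolding down_conjugates_def by blast
qed

lemma down_conjugates_epi_line1:
  assumes "X \<in> blowdown ` epi_line1 P Q - blowdown ` epi_line2 P Q - {center (fst P), center (snd P)}"
  shows "X \<in> quadric P Q \<and> down_conjugates P Q X = {center (snd Q)}"
proof -
  obtain U V where "(X, U, V) \<in> epi_line1 P Q"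
    using assms by (auto simp: blowdown_def)
  moreover have "(X, U, V) \<notin> epi_line2 P Q"
    using assms image_eqI[of X blowdown "(X, U, V)"] by (auto simp: blowdown_def)
  ultimately have z: "(X, U, V) \<in> epi_line1 P Q - epi_line2 P Q"
    by blast
  then have blow: "(X, U, V) \<in> blowup P" and U: "U = epipole1 Q"
    by (auto simp: epi_line1_def cam1_def)
  obtain v where v: "v \<in> hvecs V"
    using hvecs_nonempty by blast
  have "cmat (fst Q) *v b' \<in> hvecs U"
    using Q.epipole1 U by simp
  \<comment> \<open>The form of Q vanishes because the first image is an epipole, so X lies on the
    quadric.\<close>
  then have off: "(X, U, V) \<in> off_centers P Q"
    using off_centers_iff[OF blow _ _ _ v] assms Q.fund_form_epipole1 by blast
  then have strict: "(X, U, V) \<in> strict_transform P Q"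
    using off_centers_subset by blast
  have "down_conjugates P Q X = {blowdown (psi P Q (X, U, V))}"
    using down_conjugates_eq[OF strict psi_epi_line1(1)[OF strict z]] assms by blast
  then show ?thesis
    using psi_epi_line1(2)[OF strict z] off by (simp add: exc_divisor_def off_centers_def blowdown_def)
qed

lemma down_conjugates_epi_line2:
  assumes "X \<in> blowdown ` epi_line2 P Q - blowdown ` epi_line1 P Q - {center (fst P), center (snd P)}"
  shows "X \<in> quadric P Q \<and> down_conjugates P Q X = {center (fst Q)}"
proof -
  obtain U V where "(X, U, V) \<in> epi_line2 P Q"
    using assms by (auto simp: blowdown_def)
  moreover have "(X, U, V) \<notin> epi_line1 P Q"
    using assms image_eqI[of X blowdown "(X, U, V)"] by (auto simp: blowdown_def)
  ultimately have z: "(X, U, V) \<in> epi_line2 P Q - epi_line1 P Q"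
    by blast
  then have blow: "(X, U, V) \<in> blowup P" and V: "V = epipole2 Q"
    by (auto simp: epi_line2_def cam2_def)
  obtain u where u: "u \<in> hvecs U"
    using hvecs_nonempty by blast
  have "cmat (snd Q) *v a' \<in> hvecs V"
    using Q.epipole2 V by simp
  then have off: "(X, U, V) \<in> off_centers P Q"
    using off_centers_iff[OF blow _ _ u] assms Q.fund_form_epipole2 by blast
  then have strict: "(X, U, V) \<in> strict_transform P Q"
    using off_centers_subset by blast
  have "down_conjugates P Q X = {blowdown (psi P Q (X, U, V))}"
    using down_conjugates_eq[OF strict psi_epi_line2(1)[OF strict z]] assms by blast
  then show ?thesis
    using psi_epi_line2(2)[OF strict z] off by (simp add: exc_divisor_def off_centers_def blowdown_def)
qed

lemma psi_domain_epi_lines: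
  "psi_domain P Q = strict_transform P Q - (epi_line1 P Q \<inter> epi_line2 P Q)"
  using strict_transform_blowup unfolding psi_domain_eq epi_line1_def epi_line2_def by blast

end

theorem lemma5p4:
  fixes P\<^sub>1 P\<^sub>2 Q\<^sub>1 Q\<^sub>2 :: camera
    and P Q :: "camera \<times> camera"
    and p\<^sub>1 p\<^sub>2 q\<^sub>1 q\<^sub>2 :: "4 proj"
  assumes P: "P = (P\<^sub>1, P\<^sub>2)" and Q: "Q = (Q\<^sub>1, Q\<^sub>2)"
    and cameras: "is_camera P\<^sub>1" "is_camera P\<^sub>2" "is_camera Q\<^sub>1" "is_camera Q\<^sub>2"
    and centers: "p\<^sub>1 = center P\<^sub>1" "p\<^sub>2 = center P\<^sub>2" "q\<^sub>1 = center Q\<^sub>1" "q\<^sub>2 = center Q\<^sub>2"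
    and distinct: "p\<^sub>1 \<noteq> p\<^sub>2" "q\<^sub>1 \<noteq> q\<^sub>2"
    and different: "\<not> same_fund_form P Q"
  shows
    "(strict_transform_smooth P Q \<longrightarrow>
        variety_iso bbvecs bvecs (incidence P Q) (strict_transform P Q) fst)
   \<and> (psi_domain P Q = strict_transform P Q - (epi_line1 P Q \<inter> epi_line2 P Q) \<and>
      birational_map bvecs bvecs (strict_transform P Q) (strict_transform Q P)
        (psi_domain P Q) (psi P Q))
   \<and> (quadric_singular P Q \<longleftrightarrow> proj_line q\<^sub>1 q\<^sub>2 \<subseteq> quadric Q P)
   \<and> ((\<forall>x \<in> strict_transform P Q \<inter> (epi_line1 P Q - epi_line2 P Q).
          x \<in> psi_domain P Q \<and> psi P Q x \<in> exc_divisor Q q\<^sub>2) \<and>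
      (\<forall>x \<in> strict_transform P Q \<inter> (epi_line2 P Q - epi_line1 P Q).
          x \<in> psi_domain P Q \<and> psi P Q x \<in> exc_divisor Q q\<^sub>1) \<and>
      (\<forall>X \<in> blowdown ` epi_line1 P Q - blowdown ` epi_line2 P Q - {p\<^sub>1, p\<^sub>2}.
          X \<in> quadric P Q \<and> down_conjugates P Q X = {q\<^sub>2}) \<and>
      (\<forall>X \<in> blowdown ` epi_line2 P Q - blowdown ` epi_line1 P Q - {p\<^sub>1, p\<^sub>2}.
          X \<in> quadric P Q \<and> down_conjugates P Q X = {q\<^sub>1}))"
proof -
  have P': "is_camera (fst P)" "is_camera (snd P)" "center (fst P) \<noteq> center (snd P)"
    and Q': "is_camera (fst Q)" "is_camera (snd Q)" "center (fst Q) \<noteq> center (snd Q)"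
    using cameras distinct centers P Q by simp_all
  obtain a b R S where setup_P: "camera_setup P a b R S"
    using camera_setup_exists[OF P'] .
  obtain a' b' R' S' where setup_Q: "camera_setup Q a' b' R' S'"
    using camera_setup_exists[OF Q'] .
  interpret two_pairs P a b R S Q a' b' R' S'
    using setup_P setup_Q by (rule two_pairs.intro)
  have c: "p\<^sub>1 = center (fst P)" "p\<^sub>2 = center (snd P)" "q\<^sub>1 = center (fst Q)" "q\<^sub>2 = center (snd Q)"
    using centers P Q by simp_all
  show ?thesis
    unfolding c
  proof (intro conjI impI ballI)
    show "variety_iso bbvecs bvecs (incidence P Q) (strict_transform P Q) fst"
      if "strict_transform_smooth P Q"
      using iso_fst[OF smooth_imp_psi_domain[OF that]] .
    show "quadric_singular P Q \<longleftrightarrow> proj_line (center (fst Q)) (center (snd Q)) \<subseteq> quadric Q P"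
      unfolding epipoles_fund_form_iff_singular baseline_in_quadric_iff ..
  qed (use psi_domain_epi_lines birational_psi psi_epi_line1 psi_epi_line2
      down_conjugates_epi_line1 down_conjugates_epi_line2 in blast)+
qed

end
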